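(* Let $\phi$ be a monotone 3-CNF formula (no negated variables, each clause has three distinct variables) and let $H_\phi$ be the trapezoid graph constructed from $\phi$ as described in the context. Then $\phi$ is NAE-satisfiable if and only if $H_\phi$ is a bounded tolerance graph.
   Context: A formula is NAE-satisfiable if there is a truth assignment such that every clause contains at least one true and at least one false variable. Tolerance / bounded tolerance graphs: $G$ on $v_1,\dots,v_n$ is a tolerance graph if there are closed intervals $I_i$ and positive reals $t_i$ with $v_iv_j\in E$ iff $|I_i\cap I_j|\ge\min\{t_i,t_j\}$; it is bounded tolerance if moreover $t_i\le |I_i|$ for all $i$. Representations: $L_1,L_2$ are two horizontal parallel lines. A permutation representation is a set of line segments ("lines") each joining a point of $L_1$ to a point of $L_2$, all endpoints distinct; its graph has the lines as vertices, adjacent iff they cross. $\theta(\ell)$ denotes the angle of line $\ell$ with $L_2$. A trapezoid with left line $p$ and right line $q$ (non-crossing, $p$ left of $q$) is the region between them; a trapezoid graph is the intersection graph of such trapezoids; a parallelogram is a trapezoid whose two lines are parallel. Construction of $R_P$ (and $P_\phi$): let $\phi=\alpha_1\wedge\cdots\wedge\alpha_k$ over variables $x_1,\ldots,x_n$, $\alpha_i=(x_{r_{i,1}}\vee x_{r_{i,2}}\vee x_{r_{i,3}})$ with $r_{i,1}<r_{i,2}<r_{i,3}$. For each occurrence $(i,j)$, $j\in\{1,2,3\}$, take a pair of crossing lines $\ell^1_{i,j},\ell^2_{i,j}$ with $\theta(\ell^1_{i,j})>\theta(\ell^2_{i,j})$; write $(a_i,c_i)=(\ell^1_{i,1},\ell^2_{i,1})$,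 $(e_i,b_i)=(\ell^1_{i,2},\ell^2_{i,2})$, $(d_i,f_i)=(\ell^1_{i,3},\ell^2_{i,3})$. Lines of different occurrences do not cross. Occurrences of variable $x_p$ lie completely to the left of occurrences of $x_{p'}$ whenever $p<p'$; occurrences of the same variable are in an arbitrary left-to-right order. For every two consecutive occurrences $(i,j)$ (left) and $(i',j')$ (right) of the same variable, add two parallel lines $u^{i',j'}_{i,j},v^{i',j'}_{i,j}$, each crossing both $\ell^1_{i,j}$ and $\ell^1_{i',j'}$ and no other line, with $\theta(\ell^1_{i,j})>\theta(u^{i',j'}_{i,j})=\theta(v^{i',j'}_{i,j})<\theta(\ell^1_{i',j'})$. This is $R_P$, with $2m$ lines, $m=6k-n$. Group the lines into $m$ pairs: $\{a_i,b_i\},\{c_i,d_i\},\{e_i,f_i\}$ for each clause, and $\{u^{i',j'}_{i,j},v^{i',j'}_{i,j}\}$ for each added pair; call them $\{u_t^1,u_t^2\}$, $t=1,\ldots,m$, with $u_t^1$ the left one of the two (non-crossing) lines. Construction of $G_\phi$ and $H_\phi$: replace in $R_P$ each pair $\{u_t^1,u_t^2\}$ by the trapezoid $T_{u_t}$ with left line $u_t^1$ and right line $u_t^2$; this gives a trapezoid representation $R_G$ of the trapezoid graph $G_\phi$ on $m$ vertices. Then for $t=1,\ldots,m$ in turn: let $\varepsilon$ be the smallest distance between two distinct endpoints on $L_1$ or on $L_2$ in the current representation, and add six parallelograms, each of whose lines is a horizontal translate of $u_t^1$ or $u_t^2$: $T_{u_{t,1}}$ has left and right lines at distance $\varepsilon/2$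 to the left and to the right of $u_t^1$; $T_{u_{t,2}}$ has right line at distance $\varepsilon/4$ and left line at distance $3\varepsilon/4$ to the left of $u_t^1$; $T_{u_{t,3}}$ has right line at distance $3\varepsilon/8$ and left line at distance $7\varepsilon/8$ to the left of $u_t^1$; $T_{u_{t,4}}$ has left and right lines at distance $\varepsilon/2$ to the left and to the right of $u_t^2$; $T_{u_{t,5}}$ has left line at distance $\varepsilon/4$ and right line at distance $3\varepsilon/4$ to the right of $u_t^2$; $T_{u_{t,6}}$ has left line at distance $3\varepsilon/8$ and right line at distance $7\varepsilon/8$ to the right of $u_t^2$. The resulting trapezoid graph on $7m$ vertices is $H_\phi$. *)

theory Defs
  imports "HOL-Analysis.Analysis"
begin

section \<open>Monotone 3-CNF formulas\<close>

text \<open>Variables are natural numbers, a clause without negations is its set of variables.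
  Clauses form a list, so that they carry an index and may be repeated.\<close>

type_synonym formula = "nat set list"

definition monotone_3cnf :: "formula \<Rightarrow> bool" where
  "monotone_3cnf \<phi> \<longleftrightarrow> (\<forall>C\<in>set \<phi>. finite C \<and> card C = 3)"

definition nae_satisfiable :: "formula \<Rightarrow> bool" where
  "nae_satisfiable \<phi> \<longleftrightarrow>
     (\<exists>\<tau> :: nat \<Rightarrow> bool. \<forall>C\<in>set \<phi>. (\<exists>x\<in>C. \<tau> x) \<and> (\<exists>x\<in>C. \<not> \<tau> x))"

section \<open>Tolerance graphs\<close>

type_synonym 'a graph = "'a set \<times> 'a set set"

definition tolerance_representation ::
  "'a graph \<Rightarrow> ('a \<Rightarrow> real set) \<Rightarrow> ('a \<Rightarrow> real) \<Rightarrow> bool" where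
  "tolerance_representation G I t \<longleftrightarrow>
     (\<forall>v\<in>fst G. (\<exists>a b. a \<le> b \<and> I v = {a..b}) \<and> 0 < t v) \<and>
     (\<forall>u\<in>fst G. \<forall>v\<in>fst G. u \<noteq> v \<longrightarrow>
        ({u, v} \<in> snd G \<longleftrightarrow> min (t u) (t v) \<le> measure lborel (I u \<inter> I v)))"

definition tolerance_graph :: "'a graph \<Rightarrow> bool" where
  "tolerance_graph G \<longleftrightarrow> (\<exists>I t. tolerance_representation G I t)"

definition bounded_tolerance_graph :: "'a graph \<Rightarrow> bool" where
  "bounded_tolerance_graph G \<longleftrightarrow>
     (\<exists>I t. tolerance_representation G I t \<and> (\<forall>v\<in>fst G. t v \<le> measure lborel (I v)))"

section \<open>Lines and trapezoids between two horizontal lines\<close>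

text \<open>In the complex plane, L1 is the line of imaginary part 1 and L2 the real axis.
  The pair \<open>(x, y)\<close> stands for the segment from the point at abscissa \<open>x\<close> of L1
  to the point at abscissa \<open>y\<close> of L2.\<close>

type_synonym line = "real \<times> real"

definition segment :: "line \<Rightarrow> complex set" where
  "segment p = closed_segment (Complex (fst p) 1) (Complex (snd p) 0)"

definition crosses :: "line \<Rightarrow> line \<Rightarrow> bool" where
  "crosses p q \<longleftrightarrow> segment p \<inter> segment q \<noteq> {}"

definition left_of :: "line \<Rightarrow> line \<Rightarrow> bool" where
  "left_of p q \<longleftrightarrow> fst p < fst q \<and> snd p < snd q"

text \<open>The angle in \<open>(0, \<pi>)\<close> with the positive direction of L2.\<close>

definition theta :: "line \<Rightarrow> real" where
  "theta p = Arg (Complex (fst p) 1 - Complex (snd p) 0)"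

definition shift :: "real \<Rightarrow> line \<Rightarrow> line" where
  "shift d p = (fst p + d, snd p + d)"

text \<open>A trapezoid is given by its left and its right line.  The region consists of the points
  strictly between them: two trapezoids that merely touch along their boundaries do not
  intersect.  When all endpoints are distinct this is the same as intersection of the closed
  regions.  It matters only if the smallest distance \<open>\<epsilon>\<close> used in \<open>add_six\<close> below is
  attained, on L1 or on L2, by the two lines of the very pair being processed: then the first
  and the fourth new parallelogram touch there.\<close>

type_synonym trapezoid = "line \<times> line"

definition abscissa :: "line \<Rightarrow> real \<Rightarrow> real" where
  "abscissa p h = h * fst p + (1 - h) * snd p"

definition region :: "trapezoid \<Rightarrow> complex set" where
  "region T = {z. 0 \<le> Im z \<and> Im z \<le> 1 \<and>
      abscissa (fst T) (Im z) < Re z \<and> Re z < abscissa (snd T) (Im z)}"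

definition trapezoid_graph :: "('a \<Rightarrow> trapezoid option) \<Rightarrow> 'a graph" where
  "trapezoid_graph \<rho> = (dom \<rho>,
     {{u, v} | u v. u \<in> dom \<rho> \<and> v \<in> dom \<rho> \<and> u \<noteq> v \<and>
        region (the (\<rho> u)) \<inter> region (the (\<rho> v)) \<noteq> {}})"

section \<open>The permutation representation of a formula\<close>

text \<open>An occurrence is a pair \<open>(i, j)\<close> of a clause index and a position in the clause, both
  counted from 0; the variables of a clause are taken in increasing order.\<close>

type_synonym occ = "nat \<times> nat"

definition occs :: "formula \<Rightarrow> occ set" where
  "occs \<phi> = {..<length \<phi>} \<times> {..<3}"

definition var :: "formula \<Rightarrow> occ \<Rightarrow> nat" where
  "var \<phi> x = sorted_list_of_set (\<phi> ! fst x) ! snd x"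

text \<open>\<open>Ell1 x\<close> and \<open>Ell2 x\<close> are the two crossing lines of the occurrence \<open>x\<close>;
  \<open>LinkU x y\<close> and \<open>LinkV x y\<close> are the two parallel lines added for consecutive
  occurrences \<open>x\<close> (left) and \<open>y\<close> (right) of the same variable.\<close>

datatype line_id = Ell1 occ | Ell2 occ | LinkU occ occ | LinkV occ occ

definition occ_left :: "(line_id \<Rightarrow> line) \<Rightarrow> occ \<Rightarrow> occ \<Rightarrow> bool" where
  "occ_left R x y \<longleftrightarrow> (\<forall>p\<in>{Ell1 x, Ell2 x}. \<forall>q\<in>{Ell1 y, Ell2 y}. left_of (R p) (R q))"

definition consecutive :: "formula \<Rightarrow> (line_id \<Rightarrow> line) \<Rightarrow> occ \<Rightarrow> occ \<Rightarrow> bool" where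
  "consecutive \<phi> R x y \<longleftrightarrow>
     x \<in> occs \<phi> \<and> y \<in> occs \<phi> \<and> var \<phi> x = var \<phi> y \<and> occ_left R x y \<and>
     \<not> (\<exists>z\<in>occs \<phi>. var \<phi> z = var \<phi> x \<and> occ_left R x z \<and> occ_left R z y)"

definition line_ids :: "formula \<Rightarrow> (line_id \<Rightarrow> line) \<Rightarrow> line_id set" where
  "line_ids \<phi> R = Ell1 ` occs \<phi> \<union> Ell2 ` occs \<phi> \<union>
     {LinkU x y | x y. consecutive \<phi> R x y} \<union> {LinkV x y | x y. consecutive \<phi> R x y}"

text \<open>The coordinates, and the order of the occurrences of the same variable, are left open
  by the construction.  Hence \<open>R\<close> is any representation with the required properties; only
  its values on \<open>line_ids \<phi> R\<close> are relevant.\<close>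

definition perm_representation :: "formula \<Rightarrow> (line_id \<Rightarrow> line) \<Rightarrow> bool" where
  "perm_representation \<phi> R \<longleftrightarrow>
     inj_on (\<lambda>l. fst (R l)) (line_ids \<phi> R) \<and>
     inj_on (\<lambda>l. snd (R l)) (line_ids \<phi> R) \<and>
     (\<forall>x\<in>occs \<phi>. crosses (R (Ell1 x)) (R (Ell2 x)) \<and>
        theta (R (Ell1 x)) > theta (R (Ell2 x))) \<and>
     (\<forall>x\<in>occs \<phi>. \<forall>y\<in>occs \<phi>. x \<noteq> y \<longrightarrow>
        (\<forall>p\<in>{Ell1 x, Ell2 x}. \<forall>q\<in>{Ell1 y, Ell2 y}. \<not> crosses (R p) (R q))) \<and>
     (\<forall>x\<in>occs \<phi>. \<forall>y\<in>occs \<phi>. var \<phi> x < var \<phi> y \<longrightarrow> occ_left R x y) \<and>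
     (\<forall>x y. consecutive \<phi> R x y \<longrightarrow>
        theta (R (Ell1 x)) > theta (R (LinkU x y)) \<and>
        theta (R (LinkU x y)) = theta (R (LinkV x y)) \<and>
        theta (R (LinkV x y)) < theta (R (Ell1 y)) \<and>
        (\<forall>w\<in>{LinkU x y, LinkV x y}. \<forall>l\<in>line_ids \<phi> R - {w}.
           crosses (R w) (R l) \<longleftrightarrow> l \<in> {Ell1 x, Ell1 y}))"

text \<open>With \<open>(a, c)\<close>, \<open>(e, b)\<close>, \<open>(d, f)\<close> the line pairs of the three occurrences in a
  clause, the groups of that clause are \<open>{a, b}\<close>, \<open>{c, d}\<close>, \<open>{e, f}\<close>.\<close>

definition line_groups :: "formula \<Rightarrow> (line_id \<Rightarrow> line) \<Rightarrow> line_id set set" where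
  "line_groups \<phi> R =
     (\<Union>i<length \<phi>. {{Ell1 (i, 0), Ell2 (i, 1)},
                     {Ell2 (i, 0), Ell1 (i, 2)},
                     {Ell1 (i, 1), Ell2 (i, 2)}}) \<union>
     {{LinkU x y, LinkV x y} | x y. consecutive \<phi> R x y}"

text \<open>An enumeration of the groups; the left line of each group is the first component.\<close>

definition enumerates_groups ::
  "formula \<Rightarrow> (line_id \<Rightarrow> line) \<Rightarrow> (line_id \<times> line_id) list \<Rightarrow> bool" where
  "enumerates_groups \<phi> R ps \<longleftrightarrow> distinct ps \<and>
     set ps = {(p, q). {p, q} \<in> line_groups \<phi> R \<and> left_of (R p) (R q)}"

section \<open>The trapezoid graphs of a formula\<close>

text \<open>The vertex \<open>(t, 0)\<close> is the trapezoid of the \<open>t\<close>-th group, and \<open>(t, s)\<close> for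
  \<open>1 \<le> s \<le> 6\<close> are the six parallelograms added for it.\<close>

type_synonym vertex = "nat \<times> nat"

definition R_G ::
  "(line_id \<Rightarrow> line) \<Rightarrow> (line_id \<times> line_id) list \<Rightarrow> vertex \<Rightarrow> trapezoid option" where
  "R_G R ps = (\<lambda>(t, s). if t < length ps \<and> s = 0 then Some (map_prod R R (ps ! t)) else None)"

definition endpoints1 :: "(vertex \<Rightarrow> trapezoid option) \<Rightarrow> real set" where
  "endpoints1 \<rho> = (\<Union>T\<in>ran \<rho>. {fst (fst T), fst (snd T)})"

definition endpoints2 :: "(vertex \<Rightarrow> trapezoid option) \<Rightarrow> real set" where
  "endpoints2 \<rho> = (\<Union>T\<in>ran \<rho>. {snd (fst T), snd (snd T)})"

definition min_distance :: "(vertex \<Rightarrow> trapezoid option) \<Rightarrow> real" where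
  "min_distance \<rho> = Min
     ({dist x y | x y. x \<in> endpoints1 \<rho> \<and> y \<in> endpoints1 \<rho> \<and> x \<noteq> y} \<union>
      {dist x y | x y. x \<in> endpoints2 \<rho> \<and> y \<in> endpoints2 \<rho> \<and> x \<noteq> y})"

definition add_six ::
  "nat \<Rightarrow> line \<times> line \<Rightarrow> (vertex \<Rightarrow> trapezoid option) \<Rightarrow> vertex \<Rightarrow> trapezoid option" where
  "add_six t u \<rho> = (let \<epsilon> = min_distance \<rho>; p = fst u; q = snd u in
     \<rho>((t, 1) \<mapsto> (shift (- (\<epsilon> / 2)) p, shift (\<epsilon> / 2) p),
       (t, 2) \<mapsto> (shift (- (3 * \<epsilon> / 4)) p, shift (- (\<epsilon> / 4)) p),
       (t, 3) \<mapsto> (shift (- (7 * \<epsilon> / 8)) p, shift (- (3 * \<epsilon> / 8)) p),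
       (t, 4) \<mapsto> (shift (- (\<epsilon> / 2)) q, shift (\<epsilon> / 2) q),
       (t, 5) \<mapsto> (shift (\<epsilon> / 4) q, shift (3 * \<epsilon> / 4) q),
       (t, 6) \<mapsto> (shift (3 * \<epsilon> / 8) q, shift (7 * \<epsilon> / 8) q)))"

primrec R_H_upto ::
  "(line_id \<Rightarrow> line) \<Rightarrow> (line_id \<times> line_id) list \<Rightarrow> nat \<Rightarrow> vertex \<Rightarrow> trapezoid option" where
  "R_H_upto R ps 0 = R_G R ps"
| "R_H_upto R ps (Suc t) = add_six t (map_prod R R (ps ! t)) (R_H_upto R ps t)"

definition H_graph :: "(line_id \<Rightarrow> line) \<Rightarrow> (line_id \<times> line_id) list \<Rightarrow> vertex graph" where
  "H_graph R ps = trapezoid_graph (R_H_upto R ps (length ps))"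

end

theory Submission
  imports Defs
begin

text \<open>
  A bounded tolerance representation is the same as a representation by parallelograms, in which
  both lines of every group have the same slope.

  Suppose \<open>H\<close> has such a representation.  For each line of the permutation representation, the
  trapezoid of its group and the parallelogram on the outer side of the line are disjoint, and
  the gap between them contains a line with the slope of the group.  Lines that cross originally
  give lines that cross, and if one line crosses two non-crossing ones then its slope is below
  both or above both.  Following the links, the comparison of the slopes of \<open>Ell1 x\<close> and
  \<open>Ell2 x\<close> depends only on the variable of \<open>x\<close>, which defines an assignment.  A clause whose
  variables have equal values would make the slopes of its three groups increase cyclically.

  Conversely, an assignment prescribes the order of the three slopes in each clause, without cycles
  if no clause is constant.  Small slopes in that order are given to the lines of the occurrences,
  which are placed far apart from each other; the slopes of the links are unconstrained.  The
  resulting lines have the same left-to-right relation as the original ones, and this relation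
  determines \<open>H\<close>.
\<close>

section \<open>Lines and trapezoids\<close>

definition weakly_left_of :: "line \<Rightarrow> line \<Rightarrow> bool" where
  "weakly_left_of p q \<longleftrightarrow> fst p \<le> fst q \<and> snd p \<le> snd q"

definition strictly_cross :: "line \<Rightarrow> line \<Rightarrow> bool" where
  "strictly_cross p q \<longleftrightarrow> \<not> weakly_left_of p q \<and> \<not> weakly_left_of q p"

definition disjoint_endpoints :: "line \<Rightarrow> line \<Rightarrow> bool" where
  "disjoint_endpoints p q \<longleftrightarrow> fst p \<noteq> fst q \<and> snd p \<noteq> snd q"

definition slope :: "line \<Rightarrow> real" where
  "slope p = fst p - snd p"

lemma left_of_trans: "left_of p q \<Longrightarrow> left_of q r \<Longrightarrow> left_of p r"
  by (auto simp: left_of_def)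

lemma left_of_asym: "left_of p q \<Longrightarrow> \<not> left_of q p"
  by (auto simp: left_of_def)

lemma left_of_irrefl: "\<not> left_of p p"
  by (simp add: left_of_def)

lemma left_of_weakly_left_of_trans: "left_of p q \<Longrightarrow> weakly_left_of q r \<Longrightarrow> left_of p r"
  by (auto simp: left_of_def weakly_left_of_def)

lemma weakly_left_of_left_of_trans: "weakly_left_of p q \<Longrightarrow> left_of q r \<Longrightarrow> left_of p r"
  by (auto simp: left_of_def weakly_left_of_def)

lemma left_of_imp_weakly_left_of: "left_of p q \<Longrightarrow> weakly_left_of p q"
  by (auto simp: left_of_def weakly_left_of_def)

lemma strictly_cross_commute: "strictly_cross p q \<longleftrightarrow> strictly_cross q p"
  by (auto simp: strictly_cross_def)

lemma left_of_imp_not_strictly_cross: "left_of p q \<Longrightarrow> \<not> strictly_cross p q"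
  by (simp add: strictly_cross_def left_of_imp_weakly_left_of)

lemma not_strictly_cross_imp_left_of:
  assumes "disjoint_endpoints p q" "\<not> strictly_cross p q"
  shows "left_of p q \<or> left_of q p"
  using assms
  by (auto simp: strictly_cross_def weakly_left_of_def left_of_def disjoint_endpoints_def)

lemma weakly_left_of_iff_left_of:
  "disjoint_endpoints p q \<Longrightarrow> weakly_left_of p q \<longleftrightarrow> left_of p q"
  by (auto simp: weakly_left_of_def left_of_def disjoint_endpoints_def)

lemma strictly_cross_slope_less_iff:
  assumes "strictly_cross p q"
  shows "slope p < slope q \<longleftrightarrow> fst p < fst q \<and> snd q < snd p"
  using assms by (auto simp: strictly_cross_def weakly_left_of_def slope_def)

lemma strictly_cross_imp_slope_neq: "strictly_cross p q \<Longrightarrow> slope p \<noteq> slope q"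
  by (auto simp: strictly_cross_def weakly_left_of_def slope_def)

lemma slope_shift [simp]: "slope (shift d p) = slope p"
  by (simp add: slope_def shift_def)

lemma abscissa_mono:
  assumes "weakly_left_of p q" "0 \<le> h" "h \<le> 1"
  shows "abscissa p h \<le> abscissa q h"
  using assms by (auto simp: abscissa_def weakly_left_of_def intro!: add_mono mult_left_mono)

lemma abscissa_strict_mono:
  assumes "left_of p q" "0 \<le> h" "h \<le> 1"
  shows "abscissa p h < abscissa q h"
proof (cases "h = 0")
  case False
  then have "h * fst p < h * fst q" "(1 - h) * snd p \<le> (1 - h) * snd q"
    using assms by (auto simp: left_of_def intro: mult_left_mono)
  then show ?thesis by (simp add: abscissa_def)
qed (use assms in \<open>auto simp: abscissa_def left_of_def\<close>)

lemma continuous_on_abscissa [continuous_intros]: "continuous_on A (abscissa p)"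
  unfolding abscissa_def by (intro continuous_intros)

lemma abscissa_endpoints [simp]: "abscissa p 0 = snd p" "abscissa p 1 = fst p"
  by (simp_all add: abscissa_def)

lemma mem_segment_iff:
  "z \<in> segment p \<longleftrightarrow> 0 \<le> Im z \<and> Im z \<le> 1 \<and> Re z = abscissa p (Im z)"
proof
  assume "z \<in> segment p"
  then obtain u where "0 \<le> u" "u \<le> 1"
    "z = (1 - u) *\<^sub>R Complex (fst p) 1 + u *\<^sub>R Complex (snd p) 0"
    by (auto simp: segment_def closed_segment_def)
  then show "0 \<le> Im z \<and> Im z \<le> 1 \<and> Re z = abscissa p (Im z)"
    by (simp add: abscissa_def)
next
  assume on_line: "0 \<le> Im z \<and> Im z \<le> 1 \<and> Re z = abscissa p (Im z)"
  have "z = (1 - (1 - Im z)) *\<^sub>R Complex (fst p) 1 + (1 - Im z) *\<^sub>R Complex (snd p) 0"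
    using on_line by (intro complex_eqI) (auto simp: abscissa_def)
  moreover have "0 \<le> 1 - Im z" "1 - Im z \<le> 1"
    using on_line by auto
  ultimately show "z \<in> segment p"
    unfolding segment_def closed_segment_def by blast
qed

lemma crosses_iff_abscissa_eq: "crosses p q \<longleftrightarrow> (\<exists>h\<in>{0..1}. abscissa p h = abscissa q h)"
proof
  assume "\<exists>h\<in>{0..1}. abscissa p h = abscissa q h"
  then obtain h where "h \<in> {0..1}" "abscissa p h = abscissa q h" ..
  then have "Complex (abscissa p h) h \<in> segment p \<inter> segment q"
    by (simp add: mem_segment_iff)
  then show "crosses p q"
    by (auto simp: crosses_def)
qed (force simp: crosses_def mem_segment_iff)

lemma crosses_commute: "crosses p q \<longleftrightarrow> crosses q p"
  by (auto simp: crosses_def)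

lemma left_of_imp_not_crosses:
  assumes "left_of p q"
  shows "\<not> crosses p q"
  using abscissa_strict_mono[OF assms] by (force simp: crosses_iff_abscissa_eq)

lemma opposite_order_imp_crosses:
  assumes "fst p < fst q" "snd q < snd p"
  shows "crosses p q"
proof -
  have "\<exists>h\<ge>0. h \<le> 1 \<and> abscissa q h - abscissa p h = 0"
    using assms by (intro IVT') (auto intro!: continuous_intros)
  then show ?thesis
    unfolding crosses_iff_abscissa_eq by (metis atLeastAtMost_iff eq_iff_diff_eq_0)
qed

lemma crosses_iff_strictly_cross:
  assumes "disjoint_endpoints p q"
  shows "crosses p q \<longleftrightarrow> strictly_cross p q"
proof
  assume "crosses p q"
  then have "\<not> left_of p q" "\<not> left_of q p"
    using left_of_imp_not_crosses crosses_commute by blast+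
  then show "strictly_cross p q"
    using assms
    by (auto simp: strictly_cross_def weakly_left_of_def left_of_def disjoint_endpoints_def)
next
  assume "strictly_cross p q"
  then consider "fst p < fst q" "snd q < snd p" | "fst q < fst p" "snd p < snd q"
    by (auto simp: strictly_cross_def weakly_left_of_def)
  then show "crosses p q"
    using opposite_order_imp_crosses crosses_commute by cases blast+
qed

lemma common_positive_point:
  fixes f g :: "real \<Rightarrow> real"
  assumes "a \<le> b" and cont: "continuous_on {a..b} f" "continuous_on {a..b} g"
    and sum_pos: "\<And>x. a \<le> x \<Longrightarrow> x \<le> b \<Longrightarrow> 0 < f x + g x"
    and f_pos: "0 < f a \<or> 0 < f b" and g_pos: "0 < g a \<or> 0 < g b"
  shows "\<exists>x\<in>{a..b}. 0 < f x \<and> 0 < g x"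
proof (rule ccontr)
  assume none: "\<not> ?thesis"
  have no_tie: "f x \<noteq> g x" if "a \<le> x" "x \<le> b" for x
  proof
    assume "f x = g x"
    then have "0 < f x" "0 < g x"
      using sum_pos[OF that] by auto
    with none that show False by auto
  qed
  have "\<not> (0 < f a \<and> 0 < g a)" "\<not> (0 < f b \<and> 0 < g b)"
    using none \<open>a \<le> b\<close> by auto
  then have "f a < g a \<longleftrightarrow> g b < f b"
    using f_pos g_pos by linarith
  then consider "f a - g a \<le> 0" "0 \<le> f b - g b" | "f b - g b \<le> 0" "0 \<le> f a - g a"
    by linarith
  then have "\<exists>x\<ge>a. x \<le> b \<and> f x - g x = 0"
    using IVT'[of "\<lambda>x. f x - g x" a 0 b] IVT2'[of "\<lambda>x. f x - g x" b 0 a] \<open>a \<le> b\<close> cont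
    by cases (auto intro: continuous_on_diff)
  then show False
    using no_tie by auto
qed

lemma region_disjoint_iff:
  assumes "left_of p q" "left_of p' q'"
  shows "region (p, q) \<inter> region (p', q') = {} \<longleftrightarrow> weakly_left_of q p' \<or> weakly_left_of q' p"
proof
  assume "weakly_left_of q p' \<or> weakly_left_of q' p"
  then show "region (p, q) \<inter> region (p', q') = {}"
    by (force simp: region_def dest: abscissa_mono)
next
  assume disjoint: "region (p, q) \<inter> region (p', q') = {}"
  have no_overlap: "\<not> (\<exists>h\<in>{0..1}.
      0 < abscissa q h - abscissa p' h \<and> 0 < abscissa q' h - abscissa p h)"
  proof clarify
    fix h :: real
    assume h: "h \<in> {0..1}"
      and overlap: "0 < abscissa q h - abscissa p' h" "0 < abscissa q' h - abscissa p h"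
    define x where
      "x = (max (abscissa p h) (abscissa p' h) + min (abscissa q h) (abscissa q' h)) / 2"
    have "abscissa p h < abscissa q h" "abscissa p' h < abscissa q' h"
      using abscissa_strict_mono assms h by auto
    with overlap h have "Complex x h \<in> region (p, q) \<inter> region (p', q')"
      by (auto simp: region_def x_def max_def min_def)
    with disjoint show False by blast
  qed
  have sum_pos: "0 < (abscissa q h - abscissa p' h) + (abscissa q' h - abscissa p h)"
    if "0 \<le> h" "h \<le> 1" for h
    using abscissa_strict_mono[OF assms(1) that] abscissa_strict_mono[OF assms(2) that] by linarith
  show "weakly_left_of q p' \<or> weakly_left_of q' p"
  proof (rule ccontr)
    assume "\<not> ?thesis"
    then have "\<exists>h\<in>{0..1}. 0 < abscissa q h - abscissa p' h \<and> 0 < abscissa q' h - abscissa p h"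
      by (intro common_positive_point[OF _ _ _ sum_pos])
        (auto simp: weakly_left_of_def intro!: continuous_intros)
    with no_overlap show False ..
  qed
qed

lemma trapezoid_graph_edge_iff:
  assumes "u \<in> dom \<rho>" "v \<in> dom \<rho>" "u \<noteq> v"
  shows "{u, v} \<in> snd (trapezoid_graph \<rho>) \<longleftrightarrow> region (the (\<rho> u)) \<inter> region (the (\<rho> v)) \<noteq> {}"
proof
  assume "{u, v} \<in> snd (trapezoid_graph \<rho>)"
  then obtain u' v' where "{u, v} = {u', v'}" "region (the (\<rho> u')) \<inter> region (the (\<rho> v')) \<noteq> {}"
    by (auto simp: trapezoid_graph_def)
  then show "region (the (\<rho> u)) \<inter> region (the (\<rho> v)) \<noteq> {}"
    by (metis Int_commute doubleton_eq_iff)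
next
  assume "region (the (\<rho> u)) \<inter> region (the (\<rho> v)) \<noteq> {}"
  with assms show "{u, v} \<in> snd (trapezoid_graph \<rho>)"
    unfolding trapezoid_graph_def snd_conv by blast
qed

section \<open>Parallelogram representations\<close>

definition proper_trapezoid :: "trapezoid \<Rightarrow> bool" where
  "proper_trapezoid T \<longleftrightarrow> weakly_left_of (fst T) (snd T)"

definition parallelogram :: "trapezoid \<Rightarrow> bool" where
  "parallelogram T \<longleftrightarrow> slope (fst T) = slope (snd T) \<and> proper_trapezoid T"

definition meets :: "trapezoid \<Rightarrow> trapezoid \<Rightarrow> bool" where
  "meets A B \<longleftrightarrow> \<not> left_of (snd A) (fst B) \<and> \<not> left_of (snd B) (fst A)"

definition parallelogram_representation :: "'a graph \<Rightarrow> ('a \<Rightarrow> trapezoid) \<Rightarrow> bool" where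
  "parallelogram_representation G P \<longleftrightarrow>
     (\<forall>v\<in>fst G. parallelogram (P v)) \<and>
     (\<forall>u\<in>fst G. \<forall>v\<in>fst G. u \<noteq> v \<longrightarrow> ({u, v} \<in> snd G \<longleftrightarrow> meets (P u) (P v)))"

lemma parallelogram_representationD:
  assumes "parallelogram_representation G P"
  shows "v \<in> fst G \<Longrightarrow> parallelogram (P v)"
    and "u \<in> fst G \<Longrightarrow> v \<in> fst G \<Longrightarrow> u \<noteq> v \<Longrightarrow> {u, v} \<in> snd G \<longleftrightarrow> meets (P u) (P v)"
  using assms by (auto simp: parallelogram_representation_def)

definition interval_parallelogram :: "real \<Rightarrow> real \<Rightarrow> real \<Rightarrow> trapezoid" where
  "interval_parallelogram l r t = ((l + t, l), (r, r - t))"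

definition shear :: "real \<Rightarrow> line \<Rightarrow> line" where
  "shear c p = (fst p + c, snd p)"

lemma meets_commute: "meets A B \<longleftrightarrow> meets B A"
  by (auto simp: meets_def)

lemma meets_interval_parallelograms_iff:
  assumes "0 < t" "t \<le> r - l" "0 < t'" "t' \<le> r' - l'"
  shows "meets (interval_parallelogram l r t) (interval_parallelogram l' r' t') \<longleftrightarrow>
    min t t' \<le> measure lborel ({l..r} \<inter> {l'..r'})"
proof -
  have "measure lborel ({l..r} \<inter> {l'..r'}) = max 0 (min r r' - max l l')"
    by (auto simp: Int_atLeastAtMost)
  then show ?thesis
    using assms by (auto simp: meets_def interval_parallelogram_def left_of_def min_def max_def)
qed

lemma tolerance_representation_iff_parallelogram_representation:
  assumes "\<And>v. v \<in> fst G \<Longrightarrow> 0 < t v \<and> t v \<le> r v - l v"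
  shows "tolerance_representation G (\<lambda>v. {l v..r v}) t \<longleftrightarrow>
    parallelogram_representation G (\<lambda>v. interval_parallelogram (l v) (r v) (t v))"
proof -
  have intervals: "(\<exists>a b. a \<le> b \<and> {l v..r v} = {a..b}) \<and> 0 < t v" if "v \<in> fst G" for v
    using assms[OF that] by (auto intro!: exI[of _ "l v"] exI[of _ "r v"])
  have parallelograms: "parallelogram (interval_parallelogram (l v) (r v) (t v))"
    if "v \<in> fst G" for v
    using assms[OF that]
    by (simp add: parallelogram_def proper_trapezoid_def interval_parallelogram_def slope_def
        weakly_left_of_def)
  have edges: "meets (interval_parallelogram (l u) (r u) (t u))
        (interval_parallelogram (l v) (r v) (t v))
      \<longleftrightarrow> min (t u) (t v) \<le> measure lborel ({l u..r u} \<inter> {l v..r v})"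
    if "u \<in> fst G" "v \<in> fst G" for u v
    using assms that meets_interval_parallelograms_iff by blast
  show ?thesis
    by (simp only: tolerance_representation_def parallelogram_representation_def intervals
        parallelograms edges simp_thms cong: ball_cong)
qed

lemma bounded_tolerance_imp_parallelogram_representation:
  assumes "bounded_tolerance_graph G"
  shows "\<exists>P. parallelogram_representation G P"
proof -
  from assms obtain I t where rep: "tolerance_representation G I t"
    and bounded: "\<forall>v\<in>fst G. t v \<le> measure lborel (I v)"
    by (auto simp: bounded_tolerance_graph_def)
  then have "\<forall>v\<in>fst G. \<exists>a b. a \<le> b \<and> I v = {a..b}"
    by (simp add: tolerance_representation_def)
  then obtain l r where interval: "\<And>v. v \<in> fst G \<Longrightarrow> l v \<le> r v \<and> I v = {l v..r v}"
    by metis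
  have "tolerance_representation G (\<lambda>v. {l v..r v}) t"
    using rep interval by (simp add: tolerance_representation_def)
  moreover have "0 < t v \<and> t v \<le> r v - l v" if "v \<in> fst G" for v
    using that rep bounded interval[OF that] by (auto simp: tolerance_representation_def)
  ultimately show ?thesis
    using tolerance_representation_iff_parallelogram_representation by blast
qed

lemma parallelogram_representation_shear:
  assumes "parallelogram_representation G P"
  shows "parallelogram_representation G (map_prod (shear c) (shear c) \<circ> P)"
proof -
  have "left_of (shear c p) (shear c q) \<longleftrightarrow> left_of p q" for p q
    by (simp add: left_of_def shear_def)
  moreover have "parallelogram (map_prod (shear c) (shear c) T) \<longleftrightarrow> parallelogram T" for T
    by (simp add: parallelogram_def proper_trapezoid_def shear_def slope_def weakly_left_of_def
        algebra_simps)
  ultimately show ?thesis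
    using assms by (simp add: parallelogram_representation_def meets_def)
qed

lemma parallelogram_representation_imp_bounded_tolerance:
  assumes rep: "parallelogram_representation G P" and fin: "finite (fst G)"
  shows "bounded_tolerance_graph G"
proof -
  have "bdd_above ((\<lambda>v. - slope (fst (P v))) ` fst G)"
    using fin by simp
  then obtain M where M: "- slope (fst (P v)) \<le> M" if "v \<in> fst G" for v
    by (auto simp: bdd_above_def)
  define Q where "Q = map_prod (shear (M + 1)) (shear (M + 1)) \<circ> P"
  define t where "t v = slope (fst (Q v))" for v
  define l where "l v = snd (fst (Q v))" for v
  define r where "r v = fst (snd (Q v))" for v
  have Q_rep: "parallelogram_representation G Q"
    unfolding Q_def by (rule parallelogram_representation_shear[OF rep])
  note par = parallelogram_representationD(1)[OF Q_rep]
  have bounds: "0 < t v \<and> t v \<le> r v - l v" if "v \<in> fst G" for v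
    using M[OF that] par[OF that]
    by (auto simp: t_def r_def l_def Q_def parallelogram_def proper_trapezoid_def
        weakly_left_of_def slope_def shear_def)
  have "Q v = interval_parallelogram (l v) (r v) (t v)" if "v \<in> fst G" for v
    using par[OF that]
    by (simp add: interval_parallelogram_def t_def l_def r_def parallelogram_def slope_def
        prod_eq_iff)
  with Q_rep have "parallelogram_representation G (\<lambda>v. interval_parallelogram (l v) (r v) (t v))"
    by (simp add: parallelogram_representation_def)
  then have "tolerance_representation G (\<lambda>v. {l v..r v}) t"
    using tolerance_representation_iff_parallelogram_representation bounds by blast
  moreover have "t v \<le> measure lborel {l v..r v}" if "v \<in> fst G" for v
    using bounds[OF that] by simp
  ultimately show ?thesis
    unfolding bounded_tolerance_graph_def by blast
qed

section \<open>Lines separating two trapezoids\<close>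

definition separates :: "line \<Rightarrow> trapezoid \<Rightarrow> trapezoid \<Rightarrow> bool" where
  "separates a A A' \<longleftrightarrow>
     left_of (snd A) a \<and> left_of a (fst A') \<or> left_of (snd A') a \<and> left_of a (fst A)"

definition avoids :: "line \<Rightarrow> trapezoid \<Rightarrow> bool" where
  "avoids a X \<longleftrightarrow> left_of (snd X) a \<or> left_of a (fst X)"

definition straddles :: "trapezoid \<Rightarrow> line \<Rightarrow> bool" where
  "straddles X a \<longleftrightarrow> \<not> weakly_left_of (snd X) a \<and> \<not> weakly_left_of a (fst X)"

lemma left_of_shiftE:
  assumes "left_of p q"
  obtains d where "0 < d" "left_of (shift d p) q" "left_of p (shift (- d) q)"
proof -
  define d where "d = min (fst q - fst p) (snd q - snd p) / 2"
  have "0 < d" "d < fst q - fst p" "d < snd q - snd p"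
    using assms by (auto simp: d_def left_of_def min_def)
  then show thesis
    by (intro that[of d]) (auto simp: left_of_def shift_def)
qed

lemma left_of_shift: "0 < d \<Longrightarrow> left_of p (shift d p)" "0 < d \<Longrightarrow> left_of (shift (- d) p) p"
  by (auto simp: left_of_def shift_def)

lemma exists_separating_line:
  assumes "\<not> meets A A'" "slope (fst A) = slope (snd A)"
  shows "\<exists>a. separates a A A' \<and> slope a = slope (fst A)"
proof -
  from assms(1) consider (right) "left_of (snd A) (fst A')" | (left) "left_of (snd A') (fst A)"
    by (auto simp: meets_def)
  then show ?thesis
  proof cases
    case right
    then obtain d where "0 < d" "left_of (shift d (snd A)) (fst A')"
      by (rule left_of_shiftE)
    then have "separates (shift d (snd A)) A A'"
      by (simp add: separates_def left_of_shift)
    with assms(2) show ?thesis by (intro exI[of _ "shift d (snd A)"]) simp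
  next
    case left
    then obtain d where "0 < d" "left_of (snd A') (shift (- d) (fst A))"
      by (rule left_of_shiftE)
    then have "separates (shift (- d) (fst A)) A A'"
      by (simp add: separates_def left_of_shift)
    then show ?thesis by (intro exI[of _ "shift (- d) (fst A)"]) simp
  qed
qed

lemma meets_both_sides_imp_straddles:
  assumes "separates a A A'" "meets A X" "meets A' X"
  shows "straddles X a"
  using assms left_of_weakly_left_of_trans weakly_left_of_left_of_trans
  unfolding separates_def meets_def straddles_def by blast

lemma straddles_both_sides_imp_strictly_cross:
  assumes "separates b B B'" "straddles B a" "straddles B' a"
  shows "strictly_cross a b"
  using assms left_of_weakly_left_of_trans weakly_left_of_left_of_trans left_of_imp_weakly_left_of
  unfolding separates_def straddles_def strictly_cross_def by blast

lemma straddling_trapezoid_reaches: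
  assumes "straddles X a" "proper_trapezoid X" "avoids b X"
  shows "fst b < fst a \<Longrightarrow> snd a < snd b \<Longrightarrow> fst (fst X) < fst a \<and> snd a < snd (snd X)"
    and "fst a < fst b \<Longrightarrow> snd b < snd a \<Longrightarrow> snd (fst X) < snd a \<and> fst a < fst (snd X)"
  using assms
  by (auto simp: straddles_def proper_trapezoid_def avoids_def weakly_left_of_def left_of_def)

lemma opposite_crossings_meet:
  assumes straddle: "straddles B a" "straddles C a"
    and proper: "proper_trapezoid B" "proper_trapezoid C"
    and avoid: "avoids b B" "avoids c C"
    and cross: "strictly_cross a b" "strictly_cross a c"
    and slopes: "slope b < slope a" "slope a < slope c"
  shows "meets B C"
proof -
  have "fst b < fst a" "snd a < snd b" "fst a < fst c" "snd c < snd a"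
    using strictly_cross_slope_less_iff cross strictly_cross_commute slopes by blast+
  then have "fst (fst B) < fst a" "snd a < snd (snd B)" "snd (fst C) < snd a" "fst a < fst (snd C)"
    using straddling_trapezoid_reaches[OF straddle(1) proper(1) avoid(1)]
      straddling_trapezoid_reaches[OF straddle(2) proper(2) avoid(2)] by blast+
  then show ?thesis
    by (auto simp: meets_def left_of_def)
qed

text \<open>Only \<open>B'\<close> and \<open>C'\<close> are known to be disjoint: \<open>b\<close> and \<open>c\<close> might cross a priori.\<close>

lemma crossing_slopes_less_iff:
  assumes sep_a: "separates a A A'" and sep_b: "separates b B B'" and sep_c: "separates c C C'"
    and meet_B: "\<And>X Y. X \<in> {A, A'} \<Longrightarrow> Y \<in> {B, B'} \<Longrightarrow> meets X Y"
    and meet_C: "\<And>X Y. X \<in> {A, A'} \<Longrightarrow> Y \<in> {C, C'} \<Longrightarrow> meets X Y"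
    and disjoint: "\<not> meets B' C'"
    and proper: "proper_trapezoid B'" "proper_trapezoid C'"
  shows "slope a < slope b \<longleftrightarrow> slope a < slope c"
proof -
  have straddle: "straddles B a" "straddles B' a" "straddles C a" "straddles C' a"
    using meets_both_sides_imp_straddles[OF sep_a] meet_B meet_C by blast+
  have avoid: "avoids b B'" "avoids c C'"
    using sep_b sep_c by (auto simp: separates_def avoids_def)
  have cross: "strictly_cross a b" "strictly_cross a c"
    using straddles_both_sides_imp_strictly_cross sep_b sep_c straddle by blast+
  have "\<not> (slope b < slope a \<and> slope a < slope c)" "\<not> (slope c < slope a \<and> slope a < slope b)"
    using opposite_crossings_meet[OF straddle(2,4) proper avoid cross]
      opposite_crossings_meet[OF straddle(4,2) proper(2,1) avoid(2,1) cross(2,1)]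
      disjoint meets_commute by blast+
  then show ?thesis
    using strictly_cross_imp_slope_neq[OF cross(1)] strictly_cross_imp_slope_neq[OF cross(2)]
    by linarith
qed

definition forced_slopes :: "'i set \<Rightarrow> ('i \<Rightarrow> line) \<Rightarrow> ('i \<Rightarrow> real) \<Rightarrow> bool" where
  "forced_slopes A S D \<longleftrightarrow>
     (\<forall>i\<in>A. \<forall>j\<in>A. strictly_cross (S i) (S j) \<longrightarrow> D i \<noteq> D j) \<and>
     (\<forall>i\<in>A. \<forall>j\<in>A. \<forall>k\<in>A. strictly_cross (S i) (S j) \<longrightarrow> strictly_cross (S i) (S k) \<longrightarrow>
        left_of (S j) (S k) \<longrightarrow> (D i < D j \<longleftrightarrow> D i < D k))"

lemma forced_slopesD:
  assumes "forced_slopes A S D"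
  shows "\<lbrakk>i \<in> A; j \<in> A; strictly_cross (S i) (S j)\<rbrakk> \<Longrightarrow> D i \<noteq> D j"
    and "\<lbrakk>i \<in> A; j \<in> A; k \<in> A; strictly_cross (S i) (S j); strictly_cross (S i) (S k);
      left_of (S j) (S k)\<rbrakk> \<Longrightarrow> D i < D j \<longleftrightarrow> D i < D k"
  using assms unfolding forced_slopes_def by blast+

lemma forced_slopes_reindex:
  assumes "forced_slopes A S D" and "\<And>i. i \<in> B \<Longrightarrow> f i \<in> A" "\<And>i. i \<in> B \<Longrightarrow> S (f i) = T i"
  shows "forced_slopes B T (D \<circ> f)"
  using forced_slopesD[OF assms(1)] assms(2,3) unfolding forced_slopes_def comp_def by metis

lemma separating_lines_forced_slopes:
  assumes separates: "\<And>i. i \<in> A \<Longrightarrow> separates (a i) (X i) (X' i)"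
    and meet: "\<And>i j Y Z. \<lbrakk>i \<in> A; j \<in> A; strictly_cross (S i) (S j);
      Y \<in> {X i, X' i}; Z \<in> {X j, X' j}\<rbrakk> \<Longrightarrow> meets Y Z"
    and disjoint: "\<And>i j. i \<in> A \<Longrightarrow> j \<in> A \<Longrightarrow> left_of (S i) (S j) \<Longrightarrow> \<not> meets (X' i) (X' j)"
    and proper: "\<And>i. i \<in> A \<Longrightarrow> proper_trapezoid (X' i)"
  shows "forced_slopes A S (slope \<circ> a)"
  unfolding forced_slopes_def comp_def
proof (intro conjI ballI impI)
  fix i j assume ij: "i \<in> A" "j \<in> A" "strictly_cross (S i) (S j)"
  have "straddles (X j) (a i)" "straddles (X' j) (a i)"
    using meets_both_sides_imp_straddles[OF separates[OF ij(1)]] meet[OF ij] by blast+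
  then have "strictly_cross (a i) (a j)"
    by (rule straddles_both_sides_imp_strictly_cross[OF separates[OF ij(2)]])
  then show "slope (a i) \<noteq> slope (a j)"
    by (rule strictly_cross_imp_slope_neq)
next
  fix i j k
  assume ijk: "i \<in> A" "j \<in> A" "k \<in> A" and "left_of (S j) (S k)"
    and cross: "strictly_cross (S i) (S j)" "strictly_cross (S i) (S k)"
  then show "slope (a i) < slope (a j) \<longleftrightarrow> slope (a i) < slope (a k)"
    using crossing_slopes_less_iff[OF separates[OF ijk(1)] separates[OF ijk(2)] separates[OF ijk(3)]
        meet[OF ijk(1,2) cross(1)] meet[OF ijk(1,3) cross(2)]] disjoint proper by blast
qed

section \<open>Relative position of two lines\<close>

definition apart :: "real \<Rightarrow> line \<Rightarrow> line \<Rightarrow> bool" where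
  "apart d p q \<longleftrightarrow> d \<le> \<bar>fst p - fst q\<bar> \<and> d \<le> \<bar>snd p - snd q\<bar>"

definition orientation :: "line \<Rightarrow> line \<Rightarrow> real \<times> real" where
  "orientation p q = (sgn (fst q - fst p), sgn (snd q - snd p))"

lemma apart_imp_disjoint_endpoints: "0 < d \<Longrightarrow> apart d p q \<Longrightarrow> disjoint_endpoints p q"
  by (auto simp: apart_def disjoint_endpoints_def)

lemma left_of_iff_orientation: "left_of p q \<longleftrightarrow> orientation p q = (1, 1)"
  by (auto simp: left_of_def orientation_def sgn_if)

lemma disjoint_endpoints_iff_orientation:
  "disjoint_endpoints p q \<longleftrightarrow> fst (orientation p q) \<noteq> 0 \<and> snd (orientation p q) \<noteq> 0"
  by (auto simp: disjoint_endpoints_def orientation_def sgn_if)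

lemma orientation_flip: "orientation q p = - orientation p q"
  by (simp add: orientation_def sgn_if)

lemma orientation_shift_shift:
  assumes "apart d p q" "\<bar>c\<bar> + \<bar>c'\<bar> < d"
  shows "orientation (shift c p) (shift c' q) = orientation p q"
  using assms by (auto simp: orientation_def apart_def shift_def sgn_if)

lemma finite_disjoint_endpoints_apart:
  assumes "finite A" "\<And>i j. i \<in> A \<Longrightarrow> j \<in> A \<Longrightarrow> i \<noteq> j \<Longrightarrow> disjoint_endpoints (S i) (S j)"
  shows "\<exists>d>0. \<forall>i\<in>A. \<forall>j\<in>A. i \<noteq> j \<longrightarrow> apart d (S i) (S j)"
proof -
  have "\<forall>\<^sub>F d in at_right 0. i \<noteq> j \<longrightarrow> apart d (S i) (S j)" if "i \<in> A" "j \<in> A" for i j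
  proof (cases "i = j")
    case False
    then have "0 < min \<bar>fst (S i) - fst (S j)\<bar> \<bar>snd (S i) - snd (S j)\<bar>"
      using assms(2)[OF that] by (simp add: disjoint_endpoints_def)
    then show ?thesis
      by (rule eventually_at_rightI[rotated]) (auto simp: apart_def)
  qed simp
  then have "\<forall>\<^sub>F d in at_right (0::real). \<forall>i\<in>A. \<forall>j\<in>A. i \<noteq> j \<longrightarrow> apart d (S i) (S j)"
    using assms(1) by (simp add: eventually_ball_finite)
  then have "\<forall>\<^sub>F d in at_right (0::real). 0 < d \<and> (\<forall>i\<in>A. \<forall>j\<in>A. i \<noteq> j \<longrightarrow> apart d (S i) (S j))"
    using eventually_at_right_less[of "0::real"] by (rule eventually_elim2) simp
  then show ?thesis
    using eventually_happens'[OF trivial_limit_at_right_real] by blast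
qed

section \<open>The trapezoids of a group\<close>

text \<open>The slot \<open>(b, c)\<close> stands for the translate by \<open>c * \<epsilon>\<close> of the right line of a pair if \<open>b\<close>, of
  its left line otherwise; the entries of the lists are read off from \<open>add_six\<close>.\<close>

type_synonym slot = "bool \<times> real"

definition left_slot :: "nat \<Rightarrow> slot" where
  "left_slot s = [(False, 0), (False, - 1/2), (False, - 3/4), (False, - 7/8),
     (True, - 1/2), (True, 1/4), (True, 3/8)] ! s"

definition right_slot :: "nat \<Rightarrow> slot" where
  "right_slot s = [(True, 0), (False, 1/2), (False, - 1/4), (False, - 3/8),
     (True, 1/2), (True, 3/4), (True, 7/8)] ! s"

definition slots :: "slot set" where
  "slots = left_slot ` {..6} \<union> right_slot ` {..6}"

definition slot_less :: "slot \<Rightarrow> slot \<Rightarrow> bool" where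
  "slot_less \<sigma> \<sigma>' \<longleftrightarrow> fst \<sigma> < fst \<sigma>' \<or> fst \<sigma> = fst \<sigma>' \<and> snd \<sigma> < snd \<sigma>'"

text \<open>The difference 1 is attained by the first and the fourth parallelogram, which touch if their
  pair realises the smallest distance.\<close>

definition slots_comparable :: "slot \<Rightarrow> slot \<Rightarrow> bool" where
  "slots_comparable \<sigma> \<sigma>' \<longleftrightarrow> \<sigma> \<noteq> \<sigma>' \<and> (fst \<sigma> < fst \<sigma>' \<longrightarrow> snd \<sigma> - snd \<sigma>' \<le> 1) \<and>
     (fst \<sigma>' < fst \<sigma> \<longrightarrow> snd \<sigma>' - snd \<sigma> < 1)"

abbreviation indices :: "nat \<Rightarrow> (nat \<times> bool) set" where
  "indices n \<equiv> {..<n} \<times> UNIV"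

abbreviation vertices :: "nat \<Rightarrow> vertex set" where
  "vertices n \<equiv> {..<n} \<times> {..6}"

definition slot_line :: "(nat \<times> bool \<Rightarrow> line) \<Rightarrow> (nat \<Rightarrow> real) \<Rightarrow> nat \<Rightarrow> slot \<Rightarrow> line" where
  "slot_line S e t \<sigma> = shift (snd \<sigma> * e t) (S (t, fst \<sigma>))"

definition slot_trapezoid :: "(nat \<times> bool \<Rightarrow> line) \<Rightarrow> (nat \<Rightarrow> real) \<Rightarrow> vertex \<Rightarrow> trapezoid" where
  "slot_trapezoid S e v =
     (slot_line S e (fst v) (left_slot (snd v)), slot_line S e (fst v) (right_slot (snd v)))"

lemma le_6_cases:
  "s \<le> 6 \<Longrightarrow> s = 0 \<or> s = 1 \<or> s = 2 \<or> s = 3 \<or> s = 4 \<or> s = 5 \<or> s = (6::nat)"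
  by linarith

lemma left_slot_in_slots: "s \<le> 6 \<Longrightarrow> left_slot s \<in> slots"
  and right_slot_in_slots: "s \<le> 6 \<Longrightarrow> right_slot s \<in> slots"
  by (simp_all add: slots_def)

lemma abs_slot_offset_less: "\<sigma> \<in> slots \<Longrightarrow> \<bar>snd \<sigma>\<bar> < 1"
  by (auto simp: slots_def left_slot_def right_slot_def dest!: le_6_cases)

lemma slot_less_left_right: "s \<le> 6 \<Longrightarrow> slot_less (left_slot s) (right_slot s)"
  by (auto simp: slot_less_def left_slot_def right_slot_def dest!: le_6_cases)

lemma slot_offset_eq_if_different_lines:
  "s \<le> 6 \<Longrightarrow> fst (left_slot s) \<noteq> fst (right_slot s) \<Longrightarrow>
    snd (left_slot s) = snd (right_slot s)"
  by (auto simp: slot_less_def left_slot_def right_slot_def dest!: le_6_cases)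

lemma right_left_slots_comparable:
  assumes "s \<le> 6" "s' \<le> 6" "s \<noteq> s'"
  shows "slots_comparable (right_slot s) (left_slot s')"
  using le_6_cases[OF assms(1)] le_6_cases[OF assms(2)] assms(3)
  by (auto simp: slots_comparable_def left_slot_def right_slot_def)

lemma slot_position_iff:
  fixes x y e :: real
  defines "pos \<equiv> \<lambda>\<sigma> :: slot. (if fst \<sigma> then y else x) + snd \<sigma> * e"
  assumes "0 < e" "slots_comparable \<sigma> \<sigma>'"
  shows "e \<le> y - x \<Longrightarrow> pos \<sigma> \<le> pos \<sigma>' \<longleftrightarrow> slot_less \<sigma> \<sigma>'"
    and "e < y - x \<Longrightarrow> pos \<sigma> < pos \<sigma>' \<longleftrightarrow> slot_less \<sigma> \<sigma>'"
proof -
  have diff: "pos \<sigma>' - pos \<sigma> =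
      (if fst \<sigma>' then y else x) - (if fst \<sigma> then y else x) - (snd \<sigma> - snd \<sigma>') * e"
    by (simp add: pos_def algebra_simps)
  consider (same) "fst \<sigma> = fst \<sigma>'" | (left) "fst \<sigma> < fst \<sigma>'" | (right) "fst \<sigma>' < fst \<sigma>"
    by fastforce
  then have "(pos \<sigma> \<le> pos \<sigma>' \<longleftrightarrow> slot_less \<sigma> \<sigma>') \<and>
      (e < y - x \<longrightarrow> (pos \<sigma> < pos \<sigma>' \<longleftrightarrow> slot_less \<sigma> \<sigma>'))"
    if "e \<le> y - x"
  proof cases
    case same
    then have "snd \<sigma> \<noteq> snd \<sigma>'"
      using assms(3) by (auto simp: slots_comparable_def prod_eq_iff)
    with same \<open>0 < e\<close> show ?thesis
      by (auto simp: slot_less_def pos_def)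
  next
    case left
    then have "(snd \<sigma> - snd \<sigma>') * e \<le> e"
      using assms(3) \<open>0 < e\<close> by (simp add: slots_comparable_def)
    with left show ?thesis
      using diff that by (auto simp: slot_less_def)
  next
    case right
    then have "(snd \<sigma>' - snd \<sigma>) * e < e"
      using assms(3) \<open>0 < e\<close> by (simp add: slots_comparable_def)
    with right show ?thesis
      using diff that by (auto simp: slot_less_def algebra_simps)
  qed
  then show "e \<le> y - x \<Longrightarrow> pos \<sigma> \<le> pos \<sigma>' \<longleftrightarrow> slot_less \<sigma> \<sigma>'"
    and "e < y - x \<Longrightarrow> pos \<sigma> < pos \<sigma>' \<longleftrightarrow> slot_less \<sigma> \<sigma>'"
    by simp_all
qed

lemma slot_line_order_iff:
  assumes left: "left_of (S (t, False)) (S (t, True))" and "0 < e t"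
    and s: "s \<le> 6" "s' \<le> 6" "s \<noteq> s'"
  shows "apart (e t) (S (t, False)) (S (t, True)) \<Longrightarrow>
      weakly_left_of (slot_line S e t (right_slot s)) (slot_line S e t (left_slot s'))
      \<longleftrightarrow> slot_less (right_slot s) (left_slot s')"
    and "apart (2 * e t) (S (t, False)) (S (t, True)) \<Longrightarrow>
      left_of (slot_line S e t (right_slot s)) (slot_line S e t (left_slot s'))
      \<longleftrightarrow> slot_less (right_slot s) (left_slot s')"
proof -
  note position_iff = slot_position_iff[OF \<open>0 < e t\<close> right_left_slots_comparable[OF s]]
  show "weakly_left_of (slot_line S e t (right_slot s)) (slot_line S e t (left_slot s'))
      \<longleftrightarrow> slot_less (right_slot s) (left_slot s')"
    if "apart (e t) (S (t, False)) (S (t, True))"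
  proof -
    have "e t \<le> fst (S (t, True)) - fst (S (t, False))"
      "e t \<le> snd (S (t, True)) - snd (S (t, False))"
      using that left by (auto simp: left_of_def apart_def)
    from this[THEN position_iff(1)] show ?thesis
      by (auto simp: weakly_left_of_def slot_line_def shift_def split: if_splits)
  qed
  show "left_of (slot_line S e t (right_slot s)) (slot_line S e t (left_slot s'))
      \<longleftrightarrow> slot_less (right_slot s) (left_slot s')"
    if "apart (2 * e t) (S (t, False)) (S (t, True))"
  proof -
    have "e t < fst (S (t, True)) - fst (S (t, False))"
      "e t < snd (S (t, True)) - snd (S (t, False))"
      using that left \<open>0 < e t\<close> by (auto simp: left_of_def apart_def)
    from this[THEN position_iff(2)] show ?thesis
      by (auto simp: left_of_def slot_line_def shift_def split: if_splits)
  qed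
qed

lemma slot_trapezoid_proper:
  assumes "left_of (S (t, False)) (S (t, True))" "0 < e t" "s \<le> 6"
  shows "left_of (fst (slot_trapezoid S e (t, s))) (snd (slot_trapezoid S e (t, s)))"
proof (cases "fst (left_slot s) = fst (right_slot s)")
  case True
  then have "snd (left_slot s) * e t < snd (right_slot s) * e t"
    using slot_less_left_right[OF assms(3)] assms(2) by (simp add: slot_less_def)
  with True show ?thesis
    by (simp add: slot_trapezoid_def slot_line_def left_of_def shift_def)
next
  case False
  then have "fst (left_slot s) < fst (right_slot s)" "snd (left_slot s) = snd (right_slot s)"
    using slot_less_left_right[OF assms(3)] slot_offset_eq_if_different_lines[OF assms(3)]
    by (auto simp: slot_less_def)
  with assms(1) show ?thesis
    by (simp add: slot_trapezoid_def slot_line_def left_of_def shift_def)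
qed

definition before :: "(nat \<times> bool \<Rightarrow> line) \<Rightarrow> vertex \<Rightarrow> vertex \<Rightarrow> bool" where
  "before S u v \<longleftrightarrow>
     (if fst u = fst v then slot_less (right_slot (snd u)) (left_slot (snd v))
      else left_of (S (fst u, fst (right_slot (snd u)))) (S (fst v, fst (left_slot (snd v)))))"

definition well_spread :: "nat \<Rightarrow> (nat \<times> bool \<Rightarrow> line) \<Rightarrow> (nat \<Rightarrow> real) \<Rightarrow> bool" where
  "well_spread n S e \<longleftrightarrow>
     (\<forall>t<n. left_of (S (t, False)) (S (t, True)) \<and> 0 < e t) \<and>
     (\<forall>i\<in>indices n. \<forall>j\<in>indices n. i \<noteq> j \<longrightarrow> apart (e (fst i)) (S i) (S j)) \<and>
     (\<forall>t<n. \<forall>t'<n. t \<noteq> t' \<longrightarrow> (\<forall>\<sigma>\<in>slots. \<forall>\<sigma>'\<in>slots.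
        orientation (slot_line S e t \<sigma>) (slot_line S e t' \<sigma>') =
        orientation (S (t, fst \<sigma>)) (S (t', fst \<sigma>'))))"

lemma slot_lines_of_different_groups:
  assumes "well_spread n S e" "t < n" "t' < n" "t \<noteq> t'" "\<sigma> \<in> slots" "\<sigma>' \<in> slots"
  shows "disjoint_endpoints (slot_line S e t \<sigma>) (slot_line S e t' \<sigma>')"
    and "left_of (slot_line S e t \<sigma>) (slot_line S e t' \<sigma>')
      \<longleftrightarrow> left_of (S (t, fst \<sigma>)) (S (t', fst \<sigma>'))"
proof -
  have same: "orientation (slot_line S e t \<sigma>) (slot_line S e t' \<sigma>') =
      orientation (S (t, fst \<sigma>)) (S (t', fst \<sigma>'))"
    using assms unfolding well_spread_def by blast
  have "0 < e t" "apart (e t) (S (t, fst \<sigma>)) (S (t', fst \<sigma>'))"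
    using assms unfolding well_spread_def by auto
  then show "disjoint_endpoints (slot_line S e t \<sigma>) (slot_line S e t' \<sigma>')"
    using apart_imp_disjoint_endpoints same by (simp add: disjoint_endpoints_iff_orientation)
  show "left_of (slot_line S e t \<sigma>) (slot_line S e t' \<sigma>')
      \<longleftrightarrow> left_of (S (t, fst \<sigma>)) (S (t', fst \<sigma>'))"
    using same by (simp add: left_of_iff_orientation)
qed

lemma slot_trapezoid_order_iff:
  assumes spread: "well_spread n S e" and "u \<in> vertices n" "v \<in> vertices n" "u \<noteq> v"
  shows "weakly_left_of (snd (slot_trapezoid S e u)) (fst (slot_trapezoid S e v)) \<longleftrightarrow> before S u v"
    and "(\<And>t. t < n \<Longrightarrow> apart (2 * e t) (S (t, False)) (S (t, True))) \<Longrightarrow>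
      left_of (snd (slot_trapezoid S e u)) (fst (slot_trapezoid S e v)) \<longleftrightarrow> before S u v"
proof -
  obtain t s t' s' where uv: "u = (t, s)" "v = (t', s')"
    and bounds: "t < n" "t' < n" "s \<le> 6" "s' \<le> 6"
    using assms(2,3) by auto
  have pair: "left_of (S (t, False)) (S (t, True))" "0 < e t"
    "apart (e t) (S (t, False)) (S (t, True))"
    using spread bounds(1) by (auto simp: well_spread_def)
  note same = slot_line_order_iff[where S = S and e = e, OF pair(1,2) bounds(3,4)]
  note different = slot_lines_of_different_groups[OF spread bounds(1,2) _
      right_slot_in_slots[OF bounds(3)] left_slot_in_slots[OF bounds(4)]]
  show "weakly_left_of (snd (slot_trapezoid S e u)) (fst (slot_trapezoid S e v)) \<longleftrightarrow> before S u v"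
    using same(1) pair(3) different assms(4)
    by (cases "t = t'") (simp_all add: uv before_def slot_trapezoid_def weakly_left_of_iff_left_of)
  show "left_of (snd (slot_trapezoid S e u)) (fst (slot_trapezoid S e v)) \<longleftrightarrow> before S u v"
    if "\<And>t. t < n \<Longrightarrow> apart (2 * e t) (S (t, False)) (S (t, True))"
    using same(2) that[OF bounds(1)] different(2) assms(4)
    by (cases "t = t'") (simp_all add: uv before_def slot_trapezoid_def)
qed

lemma well_spread_constant:
  assumes "0 < d"
    and apart: "\<And>i j. \<lbrakk>i \<in> indices n; j \<in> indices n; i \<noteq> j\<rbrakk> \<Longrightarrow> apart (2 * d) (S i) (S j)"
    and "\<And>t. t < n \<Longrightarrow> left_of (S (t, False)) (S (t, True))"
  shows "well_spread (n) S (\<lambda>_. d)"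
  unfolding well_spread_def
proof (intro conjI ballI allI impI)
  fix i j assume "i \<in> indices n" "j \<in> indices n" "i \<noteq> j"
  then show "apart d (S i) (S j)"
    using apart[of i j] \<open>0 < d\<close> by (simp add: apart_def)
next
  fix t t' \<sigma> \<sigma>'
  assume "t < n" "t' < n" "t \<noteq> t'" and slots: "\<sigma> \<in> slots" "\<sigma>' \<in> slots"
  then have "apart (2 * d) (S (t, fst \<sigma>)) (S (t', fst \<sigma>'))"
    by (intro apart) auto
  moreover have "\<bar>snd \<sigma> * d\<bar> < d" "\<bar>snd \<sigma>' * d\<bar> < d"
    using abs_slot_offset_less[OF slots(1)] abs_slot_offset_less[OF slots(2)] \<open>0 < d\<close>
    by (simp_all add: abs_mult)
  ultimately show "orientation (slot_line S (\<lambda>_. d) t \<sigma>) (slot_line S (\<lambda>_. d) t' \<sigma>') =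
      orientation (S (t, fst \<sigma>)) (S (t', fst \<sigma>'))"
    unfolding slot_line_def by (intro orientation_shift_shift) auto
qed (use assms in auto)

lemma before_cong:
  assumes "\<And>i j. i \<in> indices n \<Longrightarrow> j \<in> indices n \<Longrightarrow>
      left_of (S i) (S j) \<longleftrightarrow> left_of (S' i) (S' j)"
    and "u \<in> vertices n" "v \<in> vertices n"
  shows "before S u v \<longleftrightarrow> before S' u v"
  using assms by (auto simp: before_def)

section \<open>The smallest distance\<close>

definition boundary_lines :: "(vertex \<Rightarrow> trapezoid option) \<Rightarrow> line set" where
  "boundary_lines \<rho> = (\<Union>T\<in>ran \<rho>. {fst T, snd T})"

lemma endpoints_boundary_lines:
  "endpoints1 \<rho> = fst ` boundary_lines \<rho>" "endpoints2 \<rho> = snd ` boundary_lines \<rho>"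
  by (auto simp: endpoints1_def endpoints2_def boundary_lines_def)

lemma finite_distances:
  fixes E :: "real set"
  assumes "finite E"
  shows "finite {dist x y | x y. x \<in> E \<and> y \<in> E \<and> x \<noteq> y}"
  by (rule finite_subset[of _ "(\<lambda>(x, y). dist x y) ` (E \<times> E)"]) (use assms in auto)

lemma
  assumes "finite (dom \<rho>)" "p \<in> boundary_lines \<rho>" "q \<in> boundary_lines \<rho>" "disjoint_endpoints p q"
  shows min_distance_pos: "0 < min_distance \<rho>"
    and min_distance_apart: "apart (min_distance \<rho>) p q"
proof -
  let ?D = "{dist x y | x y. x \<in> endpoints1 \<rho> \<and> y \<in> endpoints1 \<rho> \<and> x \<noteq> y} \<union>
      {dist x y | x y. x \<in> endpoints2 \<rho> \<and> y \<in> endpoints2 \<rho> \<and> x \<noteq> y}"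
  have "finite (boundary_lines \<rho>)"
    using finite_ran[OF assms(1)] by (simp add: boundary_lines_def)
  then have finite: "finite ?D"
    by (simp add: endpoints_boundary_lines finite_distances)
  have distances: "dist (fst p) (fst q) \<in> ?D" "dist (snd p) (snd q) \<in> ?D"
    using assms(2-4) by (auto simp: endpoints_boundary_lines disjoint_endpoints_def)
  show "apart (min_distance \<rho>) p q"
    using Min_le[OF finite distances(1)] Min_le[OF finite distances(2)]
    by (simp add: apart_def min_distance_def dist_real_def)
  have "Min ?D \<in> ?D"
    using finite distances by (intro Min_in) auto
  then show "0 < min_distance \<rho>"
    unfolding min_distance_def by auto
qed

section \<open>Adjacency in the graph of a sequence of pairs\<close>

definition pair_line_id :: "(line_id \<times> line_id) list \<Rightarrow> nat \<times> bool \<Rightarrow> line_id" where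
  "pair_line_id ps i = (if snd i then snd else fst) (ps ! fst i)"

locale line_pairs =
  fixes R :: "line_id \<Rightarrow> line" and ps :: "(line_id \<times> line_id) list"
  assumes pair_left_of:
      "t < length ps \<Longrightarrow> left_of (R (pair_line_id ps (t, False))) (R (pair_line_id ps (t, True)))"
    and pair_lines_disjoint_endpoints:
      "\<lbrakk>i \<in> indices (length ps); j \<in> indices (length ps); i \<noteq> j\<rbrakk> \<Longrightarrow>
        disjoint_endpoints (R (pair_line_id ps i)) (R (pair_line_id ps j))"
begin

abbreviation "I \<equiv> indices (length ps)"

abbreviation "V \<equiv> vertices (length ps)"

definition base :: "nat \<times> bool \<Rightarrow> line" where
  "base i = R (pair_line_id ps i)"

definition eps :: "nat \<Rightarrow> real" where
  "eps t = min_distance (R_H_upto R ps t)"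

lemma add_six_eq:
  "add_six t (map_prod R R (ps ! t)) (R_H_upto R ps t) (t', s) =
    (if t' = t \<and> s \<in> {1..6} then Some (slot_trapezoid base eps (t, s))
     else R_H_upto R ps t (t', s))"
proof (cases "t' = t \<and> s \<in> {1..6}")
  case True
  then have "t' = t" "s = 1 \<or> s = 2 \<or> s = 3 \<or> s = 4 \<or> s = 5 \<or> s = 6" by auto
  then show ?thesis
    by (elim disjE) (simp_all add: add_six_def Let_def eps_def[symmetric] slot_trapezoid_def
        slot_line_def left_slot_def right_slot_def base_def pair_line_id_def)
qed (auto simp: add_six_def Let_def)

lemma R_G_eq:
  "R_G R ps (t, s) =
    (if t < length ps \<and> s = 0 then Some (slot_trapezoid base eps (t, s)) else None)"
  by (simp add: R_G_def slot_trapezoid_def slot_line_def left_slot_def right_slot_def base_def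
      pair_line_id_def shift_def prod_eq_iff)

lemma R_H_upto_eq:
  assumes "n \<le> length ps"
  shows "R_H_upto R ps n (t, s) = (if t < length ps \<and> s = 0 \<or> t < n \<and> s \<in> {1..6}
    then Some (slot_trapezoid base eps (t, s)) else None)"
  using assms by (induction n) (auto simp: R_G_eq add_six_eq less_Suc_eq)

lemma dom_R_H_upto:
  assumes "n \<le> length ps"
  shows "dom (R_H_upto R ps n) = {..<length ps} \<times> {0} \<union> {..<n} \<times> {1..6}"
proof (rule set_eqI)
  fix v
  show "v \<in> dom (R_H_upto R ps n) \<longleftrightarrow> v \<in> {..<length ps} \<times> {0} \<union> {..<n} \<times> {1..6}"
    by (cases v) (simp add: domIff R_H_upto_eq[OF assms] del: not_None_eq)
qed

lemma slot_line_in_boundary_lines: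
  assumes "n \<le> length ps" "t < n" "\<sigma> \<in> slots"
  shows "slot_line base eps t \<sigma> \<in> boundary_lines (R_H_upto R ps n)"
proof -
  obtain s where s: "s \<le> 6" "\<sigma> = left_slot s \<or> \<sigma> = right_slot s"
    using assms(3) by (auto simp: slots_def)
  have "R_H_upto R ps n (t, s) = Some (slot_trapezoid base eps (t, s))"
    using assms(1,2) s(1) by (auto simp: R_H_upto_eq)
  then have "slot_trapezoid base eps (t, s) \<in> ran (R_H_upto R ps n)"
    by (rule ranI)
  then show ?thesis
    using s(2) by (force simp: boundary_lines_def slot_trapezoid_def)
qed

lemma base_in_boundary_lines:
  assumes "n \<le> length ps" "i \<in> I"
  shows "base i \<in> boundary_lines (R_H_upto R ps n)"
proof -
  obtain t b where i: "i = (t, b)" "t < length ps"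
    using assms(2) by auto
  then have "R_H_upto R ps n (t, 0) = Some (slot_trapezoid base eps (t, 0))"
    using assms(1) by (simp add: R_H_upto_eq)
  then have "slot_trapezoid base eps (t, 0) \<in> ran (R_H_upto R ps n)"
    by (rule ranI)
  moreover have "slot_trapezoid base eps (t, 0) = (base (t, False), base (t, True))"
    by (simp add: slot_trapezoid_def slot_line_def left_slot_def right_slot_def shift_def)
  ultimately show ?thesis
    by (cases b) (force simp: boundary_lines_def i)+
qed

lemma base_disjoint_endpoints: "i \<in> I \<Longrightarrow> j \<in> I \<Longrightarrow> i \<noteq> j \<Longrightarrow> disjoint_endpoints (base i) (base j)"
  using pair_lines_disjoint_endpoints by (simp add: base_def)

lemma eps_apart:
  assumes "t < length ps" "p \<in> boundary_lines (R_H_upto R ps t)"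
    "q \<in> boundary_lines (R_H_upto R ps t)" "disjoint_endpoints p q"
  shows "0 < eps t" "apart (eps t) p q"
proof -
  have "finite (dom (R_H_upto R ps t))"
    using assms(1) by (simp add: dom_R_H_upto)
  then show "0 < eps t" "apart (eps t) p q"
    unfolding eps_def using min_distance_pos min_distance_apart assms(2-4) by blast+
qed

lemma eps_pos: "t < length ps \<Longrightarrow> 0 < eps t"
  using eps_apart(1)[of t "base (t, False)" "base (t, True)"]
  by (simp add: base_in_boundary_lines base_disjoint_endpoints)

lemma base_apart: "t < length ps \<Longrightarrow> i \<in> I \<Longrightarrow> j \<in> I \<Longrightarrow> i \<noteq> j \<Longrightarrow> apart (eps t) (base i) (base j)"
  by (intro eps_apart base_in_boundary_lines base_disjoint_endpoints) simp_all

lemma abs_slot_shift_less: "t < length ps \<Longrightarrow> \<sigma> \<in> slots \<Longrightarrow> \<bar>snd \<sigma> * eps t\<bar> < eps t"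
  using abs_slot_offset_less[of \<sigma>] eps_pos[of t] by (simp add: abs_mult)

text \<open>The later distance is at most the gaps between the lines present when it is chosen, among them
  the translates for the earlier pair.\<close>

lemma orientation_slot_lines_less:
  assumes "t < t'" "t' < length ps" "\<sigma> \<in> slots" "\<sigma>' \<in> slots"
  shows "orientation (slot_line base eps t \<sigma>) (slot_line base eps t' \<sigma>') =
    orientation (base (t, fst \<sigma>)) (base (t', fst \<sigma>'))"
proof -
  define p where "p = slot_line base eps t \<sigma>"
  define q where "q = base (t', fst \<sigma>')"
  have t: "t < length ps" and q: "(t', fst \<sigma>') \<in> I" and "(t, fst \<sigma>) \<noteq> (t', fst \<sigma>')"
    using assms by auto
  then have "apart (eps t) (base (t, fst \<sigma>)) q" "disjoint_endpoints (base (t, fst \<sigma>)) q"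
    using base_apart base_disjoint_endpoints by (simp_all add: q_def)
  moreover from this(1) have first: "orientation p q = orientation (base (t, fst \<sigma>)) q"
    using orientation_shift_shift[where c' = 0] abs_slot_shift_less[OF t assms(3)]
    by (fastforce simp: p_def slot_line_def shift_def)
  ultimately have "disjoint_endpoints p q"
    by (simp add: disjoint_endpoints_iff_orientation)
  then have "apart (eps t') p q"
    using eps_apart(2)[OF assms(2)] slot_line_in_boundary_lines base_in_boundary_lines assms q
    by (simp add: p_def q_def)
  then have "orientation p (slot_line base eps t' \<sigma>') = orientation p q"
    using orientation_shift_shift[where c = 0] abs_slot_shift_less[OF assms(2,4)]
    by (fastforce simp: q_def slot_line_def shift_def)
  with first show ?thesis
    by (simp add: p_def q_def)
qed

lemma well_spread_base: "well_spread (length ps) base eps"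
  unfolding well_spread_def
proof (intro conjI ballI allI impI)
  fix t assume "t < length ps"
  then show "left_of (base (t, False)) (base (t, True))" "0 < eps t"
    using pair_left_of eps_pos by (simp_all add: base_def)
next
  fix i j assume "i \<in> I" "j \<in> I" "i \<noteq> j"
  then show "apart (eps (fst i)) (base i) (base j)"
    by (intro base_apart) auto
next
  fix t t' \<sigma> \<sigma>'
  assume less: "t < length ps" "t' < length ps" and "t \<noteq> t'" and slots: "\<sigma> \<in> slots" "\<sigma>' \<in> slots"
  then consider "t < t'" | "t' < t" by linarith
  then show "orientation (slot_line base eps t \<sigma>) (slot_line base eps t' \<sigma>') =
      orientation (base (t, fst \<sigma>)) (base (t', fst \<sigma>'))"
    using orientation_slot_lines_less less slots orientation_flip by cases metis+
qed

lemma vertices_H_graph: "fst (H_graph R ps) = V"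
proof -
  have "{..6::nat} = insert 0 {1..6}" by auto
  then show ?thesis
    by (auto simp: H_graph_def trapezoid_graph_def dom_R_H_upto)
qed

lemma H_edge_iff:
  assumes "u \<in> V" "v \<in> V" "u \<noteq> v"
  shows "{u, v} \<in> snd (H_graph R ps) \<longleftrightarrow> \<not> before base u v \<and> \<not> before base v u"
proof -
  let ?\<rho> = "R_H_upto R ps (length ps)" and ?T = "slot_trapezoid base eps"
  have lookup: "the (?\<rho> w) = ?T w" if "w \<in> V" for w
    using that by (cases w) (auto simp: R_H_upto_eq)
  have proper: "left_of (fst (?T w)) (snd (?T w))" if "w \<in> V" for w
    using that slot_trapezoid_proper well_spread_base by (cases w) (auto simp: well_spread_def)
  have "dom ?\<rho> = V"
    using vertices_H_graph by (simp add: H_graph_def trapezoid_graph_def)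
  then have "{u, v} \<in> snd (H_graph R ps) \<longleftrightarrow> region (?T u) \<inter> region (?T v) \<noteq> {}"
    using trapezoid_graph_edge_iff[of u ?\<rho> v] assms lookup by (simp add: H_graph_def)
  also have "\<dots> \<longleftrightarrow> \<not> before base u v \<and> \<not> before base v u"
    using region_disjoint_iff[OF proper[OF assms(1)] proper[OF assms(2)]] assms
      slot_trapezoid_order_iff(1)[OF well_spread_base] by simp
  finally show ?thesis .
qed

section \<open>Slopes forced by a parallelogram representation\<close>

definition core :: "nat \<times> bool \<Rightarrow> vertex" where
  "core i = (fst i, 0)"

text \<open>The parallelograms 2 and 5 lie just outside the trapezoid of their group.\<close>

definition side :: "nat \<times> bool \<Rightarrow> vertex" where
  "side i = (fst i, if snd i then 5 else 2)"

lemma core_side_vertex: "i \<in> I \<Longrightarrow> v \<in> {core i, side i} \<Longrightarrow> v \<in> V"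
  by (auto simp: core_def side_def)

lemma core_side_nonadjacent:
  assumes "i \<in> I"
  shows "core i \<noteq> side i \<and> {core i, side i} \<notin> snd (H_graph R ps)"
proof -
  have distinct: "core i \<noteq> side i"
    by (simp add: core_def side_def)
  have "before base (core i) (side i) \<or> before base (side i) (core i)"
    by (simp add: before_def core_def side_def slot_less_def left_slot_def right_slot_def)
  with distinct show ?thesis
    using H_edge_iff[OF core_side_vertex core_side_vertex distinct] assms by blast
qed

lemma core_side_around_base:
  assumes "i \<in> I" "v \<in> {core i, side i}"
  shows "weakly_left_of (base (fst v, fst (left_slot (snd v)))) (base i)"
    and "weakly_left_of (base i) (base (fst v, fst (right_slot (snd v))))"
proof -
  obtain t b where i: "i = (t, b)" and "left_of (base (t, False)) (base (t, True))"
    using assms(1) pair_left_of by (auto simp: base_def)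
  then show "weakly_left_of (base (fst v, fst (left_slot (snd v)))) (base i)"
    and "weakly_left_of (base i) (base (fst v, fst (right_slot (snd v))))"
    using assms(2) unfolding i core_def side_def
    by (cases b; auto simp: left_slot_def right_slot_def weakly_left_of_def left_of_def)+
qed

lemma base_left_of_iff_same_pair:
  assumes "i \<in> I" "j \<in> I" "fst i = fst j"
  shows "left_of (base i) (base j) \<longleftrightarrow> \<not> snd i \<and> snd j"
proof -
  obtain t b b' where "i = (t, b)" "j = (t, b')"
    and "left_of (base (t, False)) (base (t, True))"
    using assms pair_left_of by (cases i; cases j) (auto simp: base_def)
  then show ?thesis
    using left_of_asym left_of_irrefl by (cases b; cases b') auto
qed

lemma crossing_adjacent:
  assumes ij: "i \<in> I" "j \<in> I" and cross: "strictly_cross (base i) (base j)"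
    and u: "u \<in> {core i, side i}" and v: "v \<in> {core j, side j}"
  shows "u \<noteq> v \<and> {u, v} \<in> snd (H_graph R ps)"
proof -
  have "\<not> left_of (base i) (base j)" "\<not> left_of (base j) (base i)" "i \<noteq> j"
    using cross by (auto simp: strictly_cross_def weakly_left_of_def left_of_def)
  then have "fst i \<noteq> fst j"
    using base_left_of_iff_same_pair[OF ij] base_left_of_iff_same_pair[OF ij(2,1)]
    by (auto simp: prod_eq_iff)
  then have distinct: "fst u \<noteq> fst v"
    using u v by (auto simp: core_def side_def)
  have "\<not> before base u v" "\<not> before base v u"
    using distinct cross core_side_around_base[OF ij(1) u] core_side_around_base[OF ij(2) v]
    by (auto simp: before_def strictly_cross_def weakly_left_of_def left_of_def)
  moreover have "u \<in> V" "v \<in> V" "u \<noteq> v"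
    using core_side_vertex[OF ij(1) u] core_side_vertex[OF ij(2) v] distinct by auto
  ultimately show ?thesis
    using H_edge_iff by blast
qed

lemma noncrossing_sides_nonadjacent:
  assumes "i \<in> I" "j \<in> I" "left_of (base i) (base j)"
  shows "side i \<noteq> side j \<and> {side i, side j} \<notin> snd (H_graph R ps)"
proof -
  have "i \<noteq> j"
    using assms(3) left_of_irrefl by blast
  then have distinct: "side i \<noteq> side j"
    by (auto simp: side_def prod_eq_iff)
  have "before base (side i) (side j)"
  proof (cases "fst i = fst j")
    case True
    then show ?thesis
      using base_left_of_iff_same_pair assms
      by (simp add: before_def side_def slot_less_def left_slot_def right_slot_def)
  next
    case False
    then show ?thesis
      using assms(3)
      by (cases i; cases j; cases "snd i"; cases "snd j")
        (simp_all add: before_def side_def left_slot_def right_slot_def)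
  qed
  with distinct show ?thesis
    using H_edge_iff[OF core_side_vertex core_side_vertex distinct] assms by blast
qed

lemma core_side_meet:
  assumes rep: "parallelogram_representation (H_graph R ps) P"
    and ij: "i \<in> I" "j \<in> I" "strictly_cross (base i) (base j)"
    and "Y \<in> {P (core i), P (side i)}" "Z \<in> {P (core j), P (side j)}"
  shows "meets Y Z"
proof -
  obtain u v where uv: "u \<in> {core i, side i}" "v \<in> {core j, side j}" and "Y = P u" "Z = P v"
    using assms(5,6) by blast
  with crossing_adjacent[OF ij uv] show ?thesis
    using parallelogram_representationD(2)[OF rep, unfolded vertices_H_graph,
        OF core_side_vertex[OF ij(1) uv(1)] core_side_vertex[OF ij(2) uv(2)]] by blast
qed

lemma exists_separating_line_core_side:
  assumes "parallelogram_representation (H_graph R ps) P" and i: "i \<in> I"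
  shows "\<exists>a. separates a (P (core i)) (P (side i)) \<and> slope a = slope (fst (P (fst i, 0)))"
proof -
  have vertices: "core i \<in> V" "side i \<in> V"
    using core_side_vertex i by blast+
  then have "\<not> meets (P (core i)) (P (side i))"
    using parallelogram_representationD(2)[OF assms(1), of "core i" "side i"]
      core_side_nonadjacent[OF i] by (simp add: vertices_H_graph)
  moreover have "slope (fst (P (core i))) = slope (snd (P (core i)))"
    using parallelogram_representationD(1)[OF assms(1), of "core i"] vertices(1)
    by (simp add: vertices_H_graph parallelogram_def)
  ultimately show ?thesis
    using exists_separating_line[of "P (core i)"] by (simp add: core_def)
qed

lemma parallelogram_representation_imp_forced_slopes:
  assumes rep: "parallelogram_representation (H_graph R ps) P"
  shows "forced_slopes I base ((\<lambda>t. slope (fst (P (t, 0)))) \<circ> fst)"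
proof -
  obtain a where separates: "\<And>i. i \<in> I \<Longrightarrow> separates (a i) (P (core i)) (P (side i))"
    and slope: "\<And>i. i \<in> I \<Longrightarrow> slope (a i) = slope (fst (P (fst i, 0)))"
    using exists_separating_line_core_side[OF rep] by metis
  have disjoint: "\<not> meets (P (side i)) (P (side j))"
    if "i \<in> I" "j \<in> I" "left_of (base i) (base j)" for i j
    using noncrossing_sides_nonadjacent[OF that] core_side_vertex[OF that(1)]
      core_side_vertex[OF that(2)] parallelogram_representationD(2)[OF rep, of "side i" "side j"]
    by (simp add: vertices_H_graph)
  have proper: "proper_trapezoid (P (side i))" if "i \<in> I" for i
    using parallelogram_representationD(1)[OF rep, of "side i"] core_side_vertex[OF that]
    by (simp add: vertices_H_graph parallelogram_def)
  have "forced_slopes I base (slope \<circ> a)"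
    using separates core_side_meet[OF rep] disjoint proper
    by (rule separating_lines_forced_slopes)
  then show ?thesis
    using slope unfolding forced_slopes_def comp_def by simp
qed

section \<open>Parallel redrawings\<close>

definition parallel_redrawing :: "(nat \<times> bool \<Rightarrow> line) \<Rightarrow> bool" where
  "parallel_redrawing S \<longleftrightarrow>
     (\<forall>t<length ps. slope (S (t, False)) = slope (S (t, True))) \<and>
     (\<forall>i\<in>I. \<forall>j\<in>I. left_of (S i) (S j) \<longleftrightarrow> left_of (base i) (base j)) \<and>
     (\<forall>i\<in>I. \<forall>j\<in>I. i \<noteq> j \<longrightarrow> disjoint_endpoints (S i) (S j))"

lemma parallel_redrawing_imp_parallelogram_representation:
  assumes "parallel_redrawing S"
  shows "\<exists>P. parallelogram_representation (H_graph R ps) P"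
proof -
  have parallel: "slope (S (t, b)) = slope (S (t, b'))" if "t < length ps" for t b b'
    using assms that by (cases b; cases b') (auto simp: parallel_redrawing_def)
  have left_iff: "left_of (S i) (S j) \<longleftrightarrow> left_of (base i) (base j)" if "i \<in> I" "j \<in> I" for i j
    using assms that unfolding parallel_redrawing_def by blast
  have left: "left_of (S (t, False)) (S (t, True))" if "t < length ps" for t
    using left_iff[of "(t, False)" "(t, True)"] pair_left_of that by (simp add: base_def)
  obtain d where "0 < d" and far: "\<forall>i\<in>I. \<forall>j\<in>I. i \<noteq> j \<longrightarrow> apart d (S i) (S j)"
    using finite_disjoint_endpoints_apart[of I S] assms unfolding parallel_redrawing_def by auto
  define e where "e = (\<lambda>_ :: nat. d / 2)"
  have spread: "well_spread (length ps) S e"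
    unfolding e_def using \<open>0 < d\<close> far left by (intro well_spread_constant) auto
  have wide: "apart (2 * e t) (S (t, False)) (S (t, True))" if "t < length ps" for t
    using far that by (simp add: e_def)
  have "parallelogram (slot_trapezoid S e v)" if vertex: "v \<in> V" for v
  proof -
    obtain t s where v: "v = (t, s)" "t < length ps" "s \<le> 6"
      using vertex by auto
    have "slope (fst (slot_trapezoid S e v)) = slope (snd (slot_trapezoid S e v))"
      using parallel[OF v(2), of "fst (left_slot s)" "fst (right_slot s)"]
      by (simp add: slot_trapezoid_def slot_line_def v(1))
    moreover have "proper_trapezoid (slot_trapezoid S e v)"
      unfolding v(1) proper_trapezoid_def using \<open>0 < d\<close>
      by (intro left_of_imp_weakly_left_of slot_trapezoid_proper left v) (simp add: e_def)
    ultimately show ?thesis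
      by (simp add: parallelogram_def)
  qed
  moreover have "{u, v} \<in> snd (H_graph R ps) \<longleftrightarrow> meets (slot_trapezoid S e u) (slot_trapezoid S e v)"
    if uv: "u \<in> V" "v \<in> V" "u \<noteq> v" for u v
    using H_edge_iff[OF uv] slot_trapezoid_order_iff(2)[OF spread _ _ _ wide] uv
      before_cong[of "length ps" S base, OF left_iff] by (auto simp: meets_def)
  ultimately show ?thesis
    unfolding parallelogram_representation_def vertices_H_graph by blast
qed

lemma bounded_tolerance_imp_forced_slopes:
  assumes "bounded_tolerance_graph (H_graph R ps)"
  shows "\<exists>D. forced_slopes I base (D \<circ> fst)"
  using bounded_tolerance_imp_parallelogram_representation[OF assms]
    parallelogram_representation_imp_forced_slopes by blast

lemma parallel_redrawing_imp_bounded_tolerance: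
  assumes "parallel_redrawing S"
  shows "bounded_tolerance_graph (H_graph R ps)"
proof -
  have "finite (fst (H_graph R ps))"
    by (simp add: vertices_H_graph)
  then show ?thesis
    using parallel_redrawing_imp_parallelogram_representation[OF assms]
      parallelogram_representation_imp_bounded_tolerance by blast
qed

end

section \<open>The line arrangement of a formula\<close>

lemma occ_left_trans: "occ_left S x y \<Longrightarrow> occ_left S y z \<Longrightarrow> occ_left S x z"
  by (auto simp: occ_left_def left_of_def)

lemma occ_left_irrefl: "\<not> occ_left S x x"
  by (auto simp: occ_left_def left_of_def)

lemma occ_left_asym: "occ_left S x y \<Longrightarrow> \<not> occ_left S y x"
  using occ_left_trans occ_left_irrefl by blast

lemma crossing_pairs_occ_left:
  assumes cross: "strictly_cross (S (Ell1 x)) (S (Ell2 x))"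
      "strictly_cross (S (Ell1 y)) (S (Ell2 y))"
    and comparable: "\<forall>p\<in>{Ell1 x, Ell2 x}. \<forall>q\<in>{Ell1 y, Ell2 y}.
      left_of (S p) (S q) \<or> left_of (S q) (S p)"
    and left: "left_of (S (Ell1 x)) (S (Ell1 y))"
  shows "occ_left S x y"
proof -
  have "\<not> left_of (S (Ell1 x)) (S (Ell2 x))" "\<not> left_of (S (Ell2 y)) (S (Ell1 y))"
    using cross left_of_imp_not_strictly_cross strictly_cross_commute by blast+
  then have "\<not> left_of (S (Ell2 y)) (S (Ell1 x))" "\<not> left_of (S (Ell1 y)) (S (Ell2 x))"
    "\<not> left_of (S (Ell2 y)) (S (Ell2 x)) \<or> \<not> left_of (S (Ell2 x)) (S (Ell1 y))"
    using left left_of_trans by blast+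
  then show ?thesis
    using comparable left unfolding occ_left_def by blast
qed

lemma finite_occs: "finite (occs \<phi>)"
  by (simp add: occs_def)

lemma Ell_in_line_ids:
  "x \<in> occs \<phi> \<Longrightarrow> p \<in> {Ell1 x, Ell2 x} \<Longrightarrow> p \<in> line_ids \<phi> R"
  by (auto simp: line_ids_def)

lemma Link_in_line_ids:
  "consecutive \<phi> R x y \<Longrightarrow> w \<in> {LinkU x y, LinkV x y} \<Longrightarrow> w \<in> line_ids \<phi> R"
  unfolding line_ids_def by blast

lemma line_ids_cases:
  assumes "l \<in> line_ids \<phi> R"
  obtains (Ell) x where "x \<in> occs \<phi>" "l \<in> {Ell1 x, Ell2 x}"
  | (Link) x y where "consecutive \<phi> R x y" "l \<in> {LinkU x y, LinkV x y}"
  using assms unfolding line_ids_def by blast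

lemma consecutiveD:
  assumes "consecutive \<phi> R x y"
  shows "x \<in> occs \<phi>" "y \<in> occs \<phi>" "var \<phi> x = var \<phi> y" "occ_left R x y"
  using assms by (auto simp: consecutive_def)

text \<open>The properties of a line system that determine the left-to-right relation between all of
  its lines; they say nothing about which of two crossing lines is steeper.\<close>

definition arrangement :: "formula \<Rightarrow> (line_id \<Rightarrow> line) \<Rightarrow> (line_id \<Rightarrow> line) \<Rightarrow> bool" where
  "arrangement \<phi> R S \<longleftrightarrow>
     (\<forall>x\<in>occs \<phi>. strictly_cross (S (Ell1 x)) (S (Ell2 x))) \<and>
     (\<forall>x\<in>occs \<phi>. \<forall>y\<in>occs \<phi>. occ_left R x y \<longrightarrow> occ_left S x y) \<and>
     (\<forall>x y. consecutive \<phi> R x y \<longrightarrow>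
        (\<forall>w\<in>{LinkU x y, LinkV x y}.
           left_of (S (Ell2 x)) (S w) \<and> left_of (S w) (S (Ell2 y)) \<and>
           strictly_cross (S (Ell1 x)) (S w) \<and> strictly_cross (S (Ell1 y)) (S w)) \<and>
        (if left_of (R (LinkU x y)) (R (LinkV x y))
         then left_of (S (LinkU x y)) (S (LinkV x y))
         else left_of (S (LinkV x y)) (S (LinkU x y))))"

locale permutation_representation =
  fixes \<phi> :: formula and R :: "line_id \<Rightarrow> line"
  assumes perm: "perm_representation \<phi> R"
begin

abbreviation "L \<equiv> line_ids \<phi> R"

lemma L_disjoint_endpoints:
  assumes "p \<in> L" "q \<in> L" "p \<noteq> q"
  shows "disjoint_endpoints (R p) (R q)"
  using perm assms by (auto simp: perm_representation_def inj_on_def disjoint_endpoints_def)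

lemma crosses_iff_strictly_cross_L:
  assumes "p \<in> L" "q \<in> L" "p \<noteq> q"
  shows "crosses (R p) (R q) \<longleftrightarrow> strictly_cross (R p) (R q)"
  using crosses_iff_strictly_cross L_disjoint_endpoints[OF assms] by blast

lemma not_crosses_imp_left_of_L:
  assumes "p \<in> L" "q \<in> L" "p \<noteq> q" "\<not> crosses (R p) (R q)"
  shows "left_of (R p) (R q) \<or> left_of (R q) (R p)"
  using not_strictly_cross_imp_left_of L_disjoint_endpoints assms crosses_iff_strictly_cross_L
  by blast

lemma Ell_cross:
  assumes "x \<in> occs \<phi>"
  shows "strictly_cross (R (Ell1 x)) (R (Ell2 x))"
proof -
  have "crosses (R (Ell1 x)) (R (Ell2 x))"
    using perm assms by (simp add: perm_representation_def)
  then show ?thesis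
    using crosses_iff_strictly_cross_L[of "Ell1 x" "Ell2 x"] Ell_in_line_ids[OF assms] by simp
qed

lemma occ_left_total:
  assumes "x \<in> occs \<phi>" "y \<in> occs \<phi>" "x \<noteq> y"
  shows "occ_left R x y \<or> occ_left R y x"
proof -
  have comparable: "\<forall>p\<in>{Ell1 x, Ell2 x}. \<forall>q\<in>{Ell1 y, Ell2 y}.
      left_of (R p) (R q) \<or> left_of (R q) (R p)"
  proof (intro ballI not_crosses_imp_left_of_L)
    fix p q assume pq: "p \<in> {Ell1 x, Ell2 x}" "q \<in> {Ell1 y, Ell2 y}"
    show "p \<in> L" "q \<in> L" "p \<noteq> q"
      using Ell_in_line_ids assms pq by auto
    show "\<not> crosses (R p) (R q)"
      using perm assms pq unfolding perm_representation_def by blast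
  qed
  then have "left_of (R (Ell1 x)) (R (Ell1 y)) \<or> left_of (R (Ell1 y)) (R (Ell1 x))"
    by blast
  then show ?thesis
    using crossing_pairs_occ_left Ell_cross assms comparable by blast
qed

lemma Link_crosses_iff:
  assumes "consecutive \<phi> R x y" "w \<in> {LinkU x y, LinkV x y}" "l \<in> L" "l \<noteq> w"
  shows "crosses (R w) (R l) \<longleftrightarrow> l \<in> {Ell1 x, Ell1 y}"
  using perm assms unfolding perm_representation_def by blast

lemma Link_cross_Ell1:
  assumes "consecutive \<phi> R x y" "w \<in> {LinkU x y, LinkV x y}" "z \<in> {x, y}"
  shows "strictly_cross (R (Ell1 z)) (R w)"
proof -
  have "Ell1 z \<in> L" "w \<in> L" "Ell1 z \<noteq> w"
    using Ell_in_line_ids[of z] Link_in_line_ids[OF assms(1,2)] consecutiveD[OF assms(1)] assms(2,3)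
    by auto
  then show ?thesis
    using Link_crosses_iff[OF assms(1,2)] crosses_iff_strictly_cross_L assms(3)
      strictly_cross_commute by blast
qed

lemma Link_between_Ell2:
  assumes "consecutive \<phi> R x y" "w \<in> {LinkU x y, LinkV x y}"
  shows "left_of (R (Ell2 x)) (R w)" "left_of (R w) (R (Ell2 y))"
proof -
  note xy = consecutiveD[OF assms(1)]
  have cross: "\<not> left_of (R w) (R (Ell1 y))" "\<not> left_of (R (Ell1 x)) (R w)"
    using Link_cross_Ell1[OF assms] left_of_imp_not_strictly_cross strictly_cross_commute by blast+
  have occs: "left_of (R (Ell2 x)) (R (Ell1 y))" "left_of (R (Ell1 x)) (R (Ell2 y))"
    using xy(4) by (simp_all add: occ_left_def)
  have comparable: "left_of (R w) (R (Ell2 z)) \<or> left_of (R (Ell2 z)) (R w)" if "z \<in> {x, y}" for z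
  proof (rule not_crosses_imp_left_of_L)
    show "w \<in> L" "Ell2 z \<in> L" "w \<noteq> Ell2 z"
      using Link_in_line_ids[OF assms] Ell_in_line_ids[of z] xy assms(2) that by auto
    then show "\<not> crosses (R w) (R (Ell2 z))"
      using Link_crosses_iff[OF assms] by simp
  qed
  show "left_of (R (Ell2 x)) (R w)" "left_of (R w) (R (Ell2 y))"
    using comparable cross occs left_of_trans by blast+
qed

lemma Links_comparable:
  assumes "consecutive \<phi> R x y"
  shows "left_of (R (LinkU x y)) (R (LinkV x y)) \<or> left_of (R (LinkV x y)) (R (LinkU x y))"
proof (rule not_crosses_imp_left_of_L)
  show "LinkU x y \<in> L" "LinkV x y \<in> L" "LinkU x y \<noteq> LinkV x y"
    using Link_in_line_ids[OF assms] by auto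
  then show "\<not> crosses (R (LinkU x y)) (R (LinkV x y))"
    using Link_crosses_iff[OF assms] by simp
qed

lemma arrangement_R: "arrangement \<phi> R R"
  unfolding arrangement_def
proof (intro conjI ballI allI impI)
  fix x y w assume "consecutive \<phi> R x y" "w \<in> {LinkU x y, LinkV x y}"
  then show "left_of (R (Ell2 x)) (R w)" "left_of (R w) (R (Ell2 y))"
    "strictly_cross (R (Ell1 x)) (R w)" "strictly_cross (R (Ell1 y)) (R w)"
    using Link_between_Ell2 Link_cross_Ell1 by blast+
next
  fix x y assume "consecutive \<phi> R x y"
  then show "if left_of (R (LinkU x y)) (R (LinkV x y))
         then left_of (R (LinkU x y)) (R (LinkV x y))
         else left_of (R (LinkV x y)) (R (LinkU x y))"
    using Links_comparable[of x y] by auto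
qed (auto simp: Ell_cross)

lemma consecutive_no_between:
  assumes "consecutive \<phi> R x y" and z: "z \<in> occs \<phi>"
  shows "occ_left R z x \<or> z = x \<or> z = y \<or> occ_left R y z"
proof (rule ccontr)
  assume outside: "\<not> ?thesis"
  note xy = consecutiveD[OF assms(1)]
  from outside have "occ_left R x z" "occ_left R z y"
    using occ_left_total z xy by blast+
  then have "var \<phi> z \<noteq> var \<phi> x"
    using assms by (auto simp: consecutive_def)
  then have "var \<phi> z < var \<phi> x \<or> var \<phi> y < var \<phi> z"
    using xy(3) by linarith
  moreover have "occ_left R u v" if "u \<in> occs \<phi>" "v \<in> occs \<phi>" "var \<phi> u < var \<phi> v" for u v
    using perm that by (simp add: perm_representation_def)
  ultimately show False
    using outside z xy(1,2) by blast
qed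

lemma consecutive_pairs_ordered:
  assumes "consecutive \<phi> R x y" "consecutive \<phi> R x' y'" "(x, y) \<noteq> (x', y')"
  shows "x' = y \<or> occ_left R y x' \<or> x = y' \<or> occ_left R y' x"
proof -
  note xy = consecutiveD[OF assms(1)] and xy' = consecutiveD[OF assms(2)]
  consider (left) "occ_left R x' x" | (same) "x' = x" | (right) "x' = y \<or> occ_left R y x'"
    using consecutive_no_between[OF assms(1) xy'(1)] by blast
  then show ?thesis
  proof cases
    case left
    then show ?thesis
      using consecutive_no_between[OF assms(2) xy(1)] occ_left_asym occ_left_irrefl by blast
  next
    case same
    then have "y = y'"
      using consecutive_no_between[OF assms(1) xy'(2)] consecutive_no_between[OF assms(2) xy(2)]
        xy xy' occ_left_asym occ_left_irrefl by metis
    with same assms(3) show ?thesis by simp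
  qed auto
qed

definition always_left :: "line_id \<Rightarrow> line_id \<Rightarrow> bool" where
  "always_left p q \<longleftrightarrow> (\<forall>S. arrangement \<phi> R S \<longrightarrow> left_of (S p) (S q))"

definition always_cross :: "line_id \<Rightarrow> line_id \<Rightarrow> bool" where
  "always_cross p q \<longleftrightarrow> (\<forall>S. arrangement \<phi> R S \<longrightarrow> strictly_cross (S p) (S q))"

lemma always_left_trans: "always_left p q \<Longrightarrow> always_left q r \<Longrightarrow> always_left p r"
  unfolding always_left_def using left_of_trans by blast

lemma always_cross_commute: "always_cross p q \<longleftrightarrow> always_cross q p"
  unfolding always_cross_def using strictly_cross_commute by blast

lemma always_left_Ell:
  assumes "occ_left R x y" "x \<in> occs \<phi>" "y \<in> occs \<phi>" "p \<in> {Ell1 x, Ell2 x}" "q \<in> {Ell1 y, Ell2 y}"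
  shows "always_left p q"
  unfolding always_left_def
proof (intro allI impI)
  fix S assume "arrangement \<phi> R S"
  then have "occ_left S x y"
    using assms unfolding arrangement_def by blast
  then show "left_of (S p) (S q)"
    using assms unfolding occ_left_def by blast
qed

lemma always_Link:
  assumes "consecutive \<phi> R x y" "w \<in> {LinkU x y, LinkV x y}"
  shows "always_left (Ell2 x) w" "always_left w (Ell2 y)"
    "always_cross (Ell1 x) w" "always_cross (Ell1 y) w"
  using assms unfolding always_left_def always_cross_def arrangement_def by blast+

lemma Ell_Ell_trichotomy:
  assumes "x \<in> occs \<phi>" "p \<in> {Ell1 x, Ell2 x}" "y \<in> occs \<phi>" "q \<in> {Ell1 y, Ell2 y}" "p \<noteq> q"
  shows "always_left p q \<or> always_left q p \<or> always_cross p q"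
proof (cases "x = y")
  case True
  have "always_cross (Ell1 x) (Ell2 x)"
    using assms(1) by (simp add: always_cross_def arrangement_def)
  with True show ?thesis
    using assms always_cross_commute by auto
next
  case False
  then show ?thesis
    using occ_left_total always_left_Ell assms by blast
qed

lemma Ell_Link_trichotomy:
  assumes z: "z \<in> occs \<phi>" "p \<in> {Ell1 z, Ell2 z}"
    and link: "consecutive \<phi> R x y" "w \<in> {LinkU x y, LinkV x y}"
  shows "always_left p w \<or> always_left w p \<or> always_cross p w"
proof -
  note xy = consecutiveD[OF link(1)]
  consider (left) "occ_left R z x" | (incident) "z \<in> {x, y}" | (right) "occ_left R y z"
    using consecutive_no_between[OF link(1) z(1)] by blast
  then show ?thesis
  proof cases
    case left
    then have "always_left p (Ell2 x)"
      using always_left_Ell z xy by blast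
    then show ?thesis
      using always_left_trans always_Link(1)[OF link] by blast
  next
    case incident
    then show ?thesis
      using z(2) always_Link[OF link] by blast
  next
    case right
    then have "always_left (Ell2 y) p"
      using always_left_Ell z xy by blast
    then show ?thesis
      using always_left_trans always_Link(2)[OF link] by blast
  qed
qed

lemma Link_always_left_Link:
  assumes link: "consecutive \<phi> R x y" "w \<in> {LinkU x y, LinkV x y}"
    and link': "consecutive \<phi> R x' y'" "w' \<in> {LinkU x' y', LinkV x' y'}"
    and "x' = y \<or> occ_left R y x'"
  shows "always_left w w'"
proof -
  have "x' = y \<or> always_left (Ell2 y) (Ell2 x')"
    using assms(5) always_left_Ell consecutiveD[OF link(1)] consecutiveD[OF link'(1)] by blast
  then show ?thesis
    using always_Link(2)[OF link] always_Link(1)[OF link'] always_left_trans by blast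
qed

lemma Link_Link_trichotomy:
  assumes p: "consecutive \<phi> R x y" "p \<in> {LinkU x y, LinkV x y}"
    and q: "consecutive \<phi> R x' y'" "q \<in> {LinkU x' y', LinkV x' y'}" and "p \<noteq> q"
  shows "always_left p q \<or> always_left q p"
proof (cases "(x, y) = (x', y')")
  case True
  have "always_left (LinkU x y) (LinkV x y) \<or> always_left (LinkV x y) (LinkU x y)"
    using p(1) unfolding always_left_def arrangement_def by metis
  with True show ?thesis
    using p q \<open>p \<noteq> q\<close> by auto
next
  case False
  then show ?thesis
    using consecutive_pairs_ordered[OF p(1) q(1)] Link_always_left_Link[OF p q]
      Link_always_left_Link[OF q p] by blast
qed

lemma L_trichotomy:
  assumes "p \<in> L" "q \<in> L" "p \<noteq> q"
  shows "always_left p q \<or> always_left q p \<or> always_cross p q"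
  using assms(1)
proof (cases rule: line_ids_cases)
  case p: (Ell x)
  from assms(2) show ?thesis
  proof (cases rule: line_ids_cases)
    case (Ell y)
    then show ?thesis
      using Ell_Ell_trichotomy p assms(3) by blast
  next
    case (Link y z)
    then show ?thesis
      using Ell_Link_trichotomy p by blast
  qed
next
  case p: (Link x y)
  from assms(2) show ?thesis
  proof (cases rule: line_ids_cases)
    case (Ell z)
    then show ?thesis
      using Ell_Link_trichotomy p always_cross_commute by blast
  next
    case (Link x' y')
    then show ?thesis
      using Link_Link_trichotomy p assms(3) by blast
  qed
qed

lemma arrangement_left_of_iff:
  assumes "arrangement \<phi> R S" "p \<in> L" "q \<in> L"
  shows "left_of (S p) (S q) \<longleftrightarrow> left_of (R p) (R q)"
proof (cases "p = q")
  case False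
  then show ?thesis
    using L_trichotomy[OF assms(2,3)] assms(1) arrangement_R left_of_asym
      left_of_imp_not_strictly_cross strictly_cross_commute
    unfolding always_left_def always_cross_def by metis
qed (simp add: left_of_irrefl)

lemma arrangement_disjoint_endpoints:
  assumes "arrangement \<phi> R S" "p \<in> L" "q \<in> L" "p \<noteq> q"
  shows "disjoint_endpoints (S p) (S q)"
  using L_trichotomy[OF assms(2-)] assms(1) unfolding always_left_def always_cross_def
  by (auto simp: disjoint_endpoints_def left_of_def strictly_cross_def weakly_left_of_def)

end

section \<open>From slopes to an assignment\<close>

text \<open>Modulo 3, the groups of clause \<open>i\<close> are \<open>{Ell1 (i, j), Ell2 (i, j + 1)}\<close>.\<close>

fun mate :: "line_id \<Rightarrow> line_id" where
  "mate (Ell1 (i, j)) = Ell2 (i, (j + 1) mod 3)"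
| "mate (Ell2 (i, j)) = Ell1 (i, (j + 2) mod 3)"
| "mate (LinkU x y) = LinkV x y"
| "mate (LinkV x y) = LinkU x y"

definition nae_assignment :: "formula \<Rightarrow> (nat \<Rightarrow> bool) \<Rightarrow> bool" where
  "nae_assignment \<phi> \<tau> \<longleftrightarrow> (\<forall>C\<in>set \<phi>. (\<exists>v\<in>C. \<tau> v) \<and> (\<exists>v\<in>C. \<not> \<tau> v))"

lemma mate_in_line_ids: "l \<in> line_ids \<phi> R \<Longrightarrow> mate l \<in> line_ids \<phi> R"
  by (auto simp: line_ids_def occs_def)

lemma mate_mate: "l \<in> line_ids \<phi> R \<Longrightarrow> mate (mate l) = l"
  by (auto simp: line_ids_def occs_def mod_simps)

lemma mem_occsD:
  assumes "(i, j) \<in> occs \<phi>"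
  shows "i < length \<phi>" "j = 0 \<or> j = 1 \<or> j = 2"
  using assms by (auto simp: occs_def)

lemma clause_eq_vars:
  assumes "monotone_3cnf \<phi>" "i < length \<phi>"
  shows "\<phi> ! i = {var \<phi> (i, 0), var \<phi> (i, 1), var \<phi> (i, 2)}"
proof -
  let ?vs = "sorted_list_of_set (\<phi> ! i)"
  have clause: "finite (\<phi> ! i)" "card (\<phi> ! i) = 3"
    using assms by (auto simp: monotone_3cnf_def)
  then have "length ?vs = 3"
    by (metis length_sorted_list_of_set)
  then have "?vs = [?vs ! 0, ?vs ! 1, ?vs ! 2]"
    by (auto simp: list_eq_iff_nth_eq less_Suc_eq numeral_3_eq_3 numeral_2_eq_2)
  then have "set ?vs = {?vs ! 0, ?vs ! 1, ?vs ! 2}"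
    by (metis list.set(1) list.set(2))
  with clause show ?thesis
    by (simp add: var_def)
qed

lemma nae_assignment_iff:
  assumes "monotone_3cnf \<phi>"
  shows "nae_assignment \<phi> \<tau> \<longleftrightarrow> (\<forall>i<length \<phi>.
    (\<tau> (var \<phi> (i, 0)) \<or> \<tau> (var \<phi> (i, 1)) \<or> \<tau> (var \<phi> (i, 2))) \<and>
    \<not> (\<tau> (var \<phi> (i, 0)) \<and> \<tau> (var \<phi> (i, 1)) \<and> \<tau> (var \<phi> (i, 2))))"
  unfolding nae_assignment_def all_set_conv_all_nth using clause_eq_vars[OF assms] by auto

context permutation_representation
begin

definition consistent_slopes :: "(line_id \<Rightarrow> real) \<Rightarrow> bool" where
  "consistent_slopes D \<longleftrightarrow> forced_slopes L R D \<and> (\<forall>l\<in>L. D (mate l) = D l)"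

lemma consecutive_invariant_imp_var_invariant:
  assumes step: "\<And>x y. consecutive \<phi> R x y \<Longrightarrow> f x = f y"
    and "x \<in> occs \<phi>" "y \<in> occs \<phi>" "var \<phi> x = var \<phi> y"
  shows "f x = f y"
proof -
  define between where "between x y = {z \<in> occs \<phi>. occ_left R x z \<and> occ_left R z y}" for x y
  have finite: "finite (between x y)" for x y
    by (simp add: between_def finite_occs)
  have ordered: "f x = f y"
    if "x \<in> occs \<phi>" "y \<in> occs \<phi>" "var \<phi> x = var \<phi> y" "occ_left R x y" for x y
    using that
  proof (induction "card (between x y)" arbitrary: x y rule: less_induct)
    case less
    show ?case
    proof (cases "consecutive \<phi> R x y")
      case False
      then obtain z where z: "z \<in> occs \<phi>" "var \<phi> z = var \<phi> x" "occ_left R x z" "occ_left R z y"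
        using less.prems by (auto simp: consecutive_def)
      have "between x z \<subset> between x y" "between z y \<subset> between x y"
        using z occ_left_trans occ_left_irrefl unfolding between_def by blast+
      then have "card (between x z) < card (between x y)" "card (between z y) < card (between x y)"
        using psubset_card_mono finite by blast+
      then show ?thesis
        using less.hyps[of x z] less.hyps[of z y] z less.prems by simp
    qed (rule step)
  qed
  show ?thesis
    using ordered[OF assms(2-4)] ordered[OF assms(3,2) assms(4)[symmetric]]
      occ_left_total[OF assms(2,3)] by metis
qed

lemma forced_slopes_consecutive:
  assumes D: "forced_slopes L R D" and consec: "consecutive \<phi> R x y"
  shows "D (Ell1 x) < D (Ell2 x) \<longleftrightarrow> D (Ell1 y) < D (Ell2 y)"
proof -
  let ?w = "LinkU x y"
  have link: "?w \<in> {LinkU x y, LinkV x y}" by simp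
  note xy = consecutiveD[OF consec]
  note between = Link_between_Ell2[OF consec link]
  have L: "Ell1 x \<in> L" "Ell2 x \<in> L" "Ell1 y \<in> L" "Ell2 y \<in> L" "?w \<in> L"
    using Ell_in_line_ids xy Link_in_line_ids[OF consec link] by blast+
  have cross: "strictly_cross (R (Ell1 x)) (R ?w)" "strictly_cross (R (Ell1 y)) (R ?w)"
    using Link_cross_Ell1[OF consec link] by blast+
  have neq: "D (Ell1 x) \<noteq> D ?w" "D (Ell1 y) \<noteq> D ?w"
    using forced_slopesD(1)[OF D] L cross by blast+
  have "D (Ell1 x) < D (Ell2 x) \<longleftrightarrow> D (Ell1 x) < D ?w"
    using forced_slopesD(2)[OF D L(1,2,5)] Ell_cross[OF xy(1)] cross(1) between(1) by blast
  also have "\<dots> \<longleftrightarrow> \<not> D ?w < D (Ell1 x)"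
    using neq(1) by linarith
  also have "\<dots> \<longleftrightarrow> \<not> D ?w < D (Ell1 y)"
    using forced_slopesD(2)[OF D L(5,1,3)] cross strictly_cross_commute xy(4)
    by (auto simp: occ_left_def)
  also have "\<dots> \<longleftrightarrow> D (Ell1 y) < D ?w"
    using neq(2) by linarith
  also have "\<dots> \<longleftrightarrow> D (Ell1 y) < D (Ell2 y)"
    using forced_slopesD(2)[OF D L(3,5,4)] Ell_cross[OF xy(2)] cross(2) between(2) by blast
  finally show ?thesis .
qed

lemma consistent_slopes_clause:
  assumes D: "consistent_slopes D" and i: "i < length \<phi>"
  defines "f \<equiv> \<lambda>j. D (Ell1 (i, j)) < D (Ell2 (i, j))"
  shows "f 0 \<or> f 1 \<or> f 2" "\<not> (f 0 \<and> f 1 \<and> f 2)"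
proof -
  have L: "Ell1 (i, j) \<in> L" "Ell2 (i, j) \<in> L" if "j < 3" for j
    using Ell_in_line_ids[of "(i, j)" \<phi>] i that by (simp_all add: occs_def)
  have mate: "D (Ell2 (i, 1)) = D (Ell1 (i, 0))" "D (Ell2 (i, 2)) = D (Ell1 (i, 1))"
    "D (Ell2 (i, 0)) = D (Ell1 (i, 2))"
    using D L(1)[of 0] L(1)[of 1] L(1)[of 2] unfolding consistent_slopes_def
    by (force simp: numeral_2_eq_2)+
  have "D (Ell1 (i, j)) \<noteq> D (Ell2 (i, j))" if "j < 3" for j
    using D forced_slopesD(1) L[OF that] Ell_cross[of "(i, j)"] i that
    by (fastforce simp: occs_def consistent_slopes_def)
  from this[of 0] this[of 1] this[of 2] show "f 0 \<or> f 1 \<or> f 2" "\<not> (f 0 \<and> f 1 \<and> f 2)"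
    unfolding f_def mate by auto
qed

lemma consistent_slopes_imp_nae_satisfiable:
  assumes "monotone_3cnf \<phi>" and D: "consistent_slopes D"
  shows "nae_satisfiable \<phi>"
proof -
  define f where "f x \<longleftrightarrow> D (Ell1 x) < D (Ell2 x)" for x
  define \<tau> where "\<tau> v \<longleftrightarrow> (\<exists>x\<in>occs \<phi>. var \<phi> x = v \<and> f x)" for v
  have "f x = f y" if "x \<in> occs \<phi>" "y \<in> occs \<phi>" "var \<phi> x = var \<phi> y" for x y
    using consecutive_invariant_imp_var_invariant[of f] forced_slopes_consecutive D that
    unfolding f_def consistent_slopes_def by blast
  then have "\<tau> (var \<phi> x) \<longleftrightarrow> f x" if "x \<in> occs \<phi>" for x
    using that unfolding \<tau>_def by blast
  then have "\<tau> (var \<phi> (i, j)) \<longleftrightarrow> f (i, j)" if "i < length \<phi>" "j < 3" for i j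
    using that by (simp add: occs_def)
  then have "nae_assignment \<phi> \<tau>"
    using consistent_slopes_clause[OF D] unfolding nae_assignment_iff[OF assms(1)] f_def by simp
  then show ?thesis
    unfolding nae_satisfiable_def nae_assignment_def by blast
qed

section \<open>From an assignment to lines\<close>

definition position :: "occ \<Rightarrow> real" where
  "position x = 10 * real (card {z \<in> occs \<phi>. occ_left R z x})"

text \<open>In a clause that is not constant under \<open>\<tau>\<close>, the requirements on the slopes of its three
  groups form an acyclic tournament; the slope of a group is its number of smaller groups.\<close>

definition Ell1_slope :: "(nat \<Rightarrow> bool) \<Rightarrow> occ \<Rightarrow> real" where
  "Ell1_slope \<tau> x = of_bool (\<not> \<tau> (var \<phi> x)) + of_bool (\<tau> (var \<phi> (fst x, (snd x + 1) mod 3)))"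

definition Ell2_slope :: "(nat \<Rightarrow> bool) \<Rightarrow> occ \<Rightarrow> real" where
  "Ell2_slope \<tau> x = Ell1_slope \<tau> (fst x, (snd x + 2) mod 3)"

definition line_through :: "real \<Rightarrow> real \<Rightarrow> line" where
  "line_through x s = (x + s / 2, x - s / 2)"

definition mean_line :: "(nat \<Rightarrow> bool) \<Rightarrow> occ \<Rightarrow> line" where
  "mean_line \<tau> x = line_through (position x) ((Ell1_slope \<tau> x + Ell2_slope \<tau> x) / 2)"

definition link_line :: "(nat \<Rightarrow> bool) \<Rightarrow> occ \<Rightarrow> occ \<Rightarrow> line" where
  "link_line \<tau> x y =
     (if \<tau> (var \<phi> x) then (fst (mean_line \<tau> y), snd (mean_line \<tau> x))
      else (fst (mean_line \<tau> x), snd (mean_line \<tau> y)))"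

definition link_offset :: "occ \<Rightarrow> occ \<Rightarrow> real" where
  "link_offset x y = (if left_of (R (LinkU x y)) (R (LinkV x y)) then 1/8 else - 1/8)"

text \<open>The components of false variables are reflected: there \<open>Ell1 x\<close> gets the larger slope.\<close>

fun layout :: "(nat \<Rightarrow> bool) \<Rightarrow> line_id \<Rightarrow> line" where
  "layout \<tau> (Ell1 x) = line_through (position x) (Ell1_slope \<tau> x)"
| "layout \<tau> (Ell2 x) = line_through (position x) (Ell2_slope \<tau> x)"
| "layout \<tau> (LinkU x y) = link_line \<tau> x y"
| "layout \<tau> (LinkV x y) = shift (link_offset x y) (link_line \<tau> x y)"

lemma slope_line_through [simp]: "slope (line_through x s) = s"
  by (simp add: slope_def line_through_def)

lemma position_mono:
  assumes "occ_left R x y" "x \<in> occs \<phi>"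
  shows "position x + 10 \<le> position y"
proof -
  have "{z \<in> occs \<phi>. occ_left R z x} \<subset> {z \<in> occs \<phi>. occ_left R z y}"
    using assms occ_left_trans occ_left_irrefl by blast
  then have "card {z \<in> occs \<phi>. occ_left R z x} < card {z \<in> occs \<phi>. occ_left R z y}"
    by (intro psubset_card_mono) (simp_all add: finite_occs)
  then show ?thesis by (simp add: position_def)
qed

lemma Ell_slope_bounds:
  "0 \<le> Ell1_slope \<tau> x" "Ell1_slope \<tau> x \<le> 2" "0 \<le> Ell2_slope \<tau> x" "Ell2_slope \<tau> x \<le> 2"
  by (auto simp: Ell1_slope_def Ell2_slope_def)

lemma Ell_slope_gap:
  assumes "monotone_3cnf \<phi>" "nae_assignment \<phi> \<tau>" "x \<in> occs \<phi>"
  shows "if \<tau> (var \<phi> x) then Ell1_slope \<tau> x + 1 \<le> Ell2_slope \<tau> x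
    else Ell2_slope \<tau> x + 1 \<le> Ell1_slope \<tau> x"
proof -
  obtain i j where x: "x = (i, j)" by fastforce
  have i: "i < length \<phi>" and j: "j = 0 \<or> j = 1 \<or> j = 2"
    using mem_occsD assms(3) by (simp_all add: x)
  have "\<tau> (var \<phi> (i, 0)) \<or> \<tau> (var \<phi> (i, 1)) \<or> \<tau> (var \<phi> (i, 2))"
    "\<not> (\<tau> (var \<phi> (i, 0)) \<and> \<tau> (var \<phi> (i, 1)) \<and> \<tau> (var \<phi> (i, 2)))"
    using assms(2) i unfolding nae_assignment_iff[OF assms(1)] by blast+
  then show ?thesis
    using j by (elim disjE) (auto simp: x Ell1_slope_def Ell2_slope_def numeral_2_eq_2)
qed

lemma link_line_arrangement:
  assumes "monotone_3cnf \<phi>" "nae_assignment \<phi> \<tau>" "consecutive \<phi> R x y" "\<bar>d\<bar> \<le> 1/8"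
  defines "w \<equiv> shift d (link_line \<tau> x y)"
  shows "left_of (layout \<tau> (Ell2 x)) w \<and> left_of w (layout \<tau> (Ell2 y)) \<and>
    strictly_cross (layout \<tau> (Ell1 x)) w \<and> strictly_cross (layout \<tau> (Ell1 y)) w"
proof -
  note xy = consecutiveD[OF assms(3)]
  have far: "position x + 10 \<le> position y"
    using position_mono xy by blast
  have offset: "- 1/8 \<le> d" "d \<le> 1/8"
    using assms(4) by auto
  note bounds = far offset Ell_slope_gap[OF assms(1,2) xy(1)] Ell_slope_gap[OF assms(1,2) xy(2)]
    Ell_slope_bounds[of \<tau> x] Ell_slope_bounds[of \<tau> y]
  show ?thesis
  proof (cases "\<tau> (var \<phi> x)")
    case True
    then have "\<tau> (var \<phi> y)"
      using xy(3) by simp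
    with True bounds show ?thesis
      by (auto simp: w_def link_line_def mean_line_def line_through_def left_of_def
          strictly_cross_def weakly_left_of_def shift_def add_divide_distrib)
  next
    case False
    then have "\<not> \<tau> (var \<phi> y)"
      using xy(3) by simp
    with False bounds show ?thesis
      by (auto simp: w_def link_line_def mean_line_def line_through_def left_of_def
          strictly_cross_def weakly_left_of_def shift_def add_divide_distrib)
  qed
qed

lemma arrangement_layout:
  assumes "monotone_3cnf \<phi>" "nae_assignment \<phi> \<tau>"
  shows "arrangement \<phi> R (layout \<tau>)"
  unfolding arrangement_def
proof (intro conjI ballI allI impI)
  fix x assume "x \<in> occs \<phi>"
  from Ell_slope_gap[OF assms this]
  show "strictly_cross (layout \<tau> (Ell1 x)) (layout \<tau> (Ell2 x))"
    by (auto simp: strictly_cross_def weakly_left_of_def line_through_def split: if_splits)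
next
  fix x y assume "x \<in> occs \<phi>" "y \<in> occs \<phi>" "occ_left R x y"
  then have "position x + 10 \<le> position y"
    using position_mono by blast
  then show "occ_left (layout \<tau>) x y"
    using Ell_slope_bounds[of \<tau> x] Ell_slope_bounds[of \<tau> y]
    by (auto simp: occ_left_def left_of_def line_through_def)
next
  fix x y w assume consec: "consecutive \<phi> R x y" and w: "w \<in> {LinkU x y, LinkV x y}"
  define d where "d = (if w = LinkU x y then 0 else link_offset x y)"
  have "\<bar>d\<bar> \<le> 1/8" "layout \<tau> w = shift d (link_line \<tau> x y)"
    using w by (auto simp: d_def shift_def link_offset_def)
  then show "left_of (layout \<tau> (Ell2 x)) (layout \<tau> w)" "left_of (layout \<tau> w) (layout \<tau> (Ell2 y))"
    "strictly_cross (layout \<tau> (Ell1 x)) (layout \<tau> w)"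
    "strictly_cross (layout \<tau> (Ell1 y)) (layout \<tau> w)"
    using link_line_arrangement[OF assms consec] by simp_all
next
  fix x y
  show "if left_of (R (LinkU x y)) (R (LinkV x y))
         then left_of (layout \<tau> (LinkU x y)) (layout \<tau> (LinkV x y))
         else left_of (layout \<tau> (LinkV x y)) (layout \<tau> (LinkU x y))"
    by (auto simp: left_of_def shift_def link_offset_def)
qed

lemma slope_layout_mate:
  assumes "l \<in> L"
  shows "slope (layout \<tau> (mate l)) = slope (layout \<tau> l)"
  using assms
proof (cases rule: line_ids_cases)
  case (Ell x)
  obtain i j where x: "x = (i, j)" by fastforce
  have "((j + 1) mod 3 + 2) mod 3 = j"
    using Ell(1) by (auto simp: x occs_def mod_simps)
  with Ell(2) show ?thesis
    by (auto simp: x Ell2_slope_def)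
next
  case (Link x y)
  then show ?thesis by auto
qed

end

section \<open>The groups of a formula\<close>

locale grouped_representation = permutation_representation +
  fixes ps :: "(line_id \<times> line_id) list"
  assumes groups: "enumerates_groups \<phi> R ps"
begin

lemma line_groups_iff: "{p, q} \<in> line_groups \<phi> R \<longleftrightarrow> p \<in> L \<and> q = mate p"
proof
  assume "{p, q} \<in> line_groups \<phi> R"
  then show "p \<in> L \<and> q = mate p"
    by (auto simp: line_groups_def line_ids_def occs_def doubleton_eq_iff)
next
  assume p: "p \<in> L \<and> q = mate p"
  then have "p \<in> L" by blast
  then show "{p, q} \<in> line_groups \<phi> R"
  proof (cases rule: line_ids_cases)
    case (Ell x)
    obtain i j where x: "x = (i, j)" by fastforce
    show ?thesis
      using mem_occsD[of i j \<phi>] Ell p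
      by (auto simp: x line_groups_def doubleton_eq_iff numeral_2_eq_2)
  next
    case (Link x y)
    then have "{p, q} = {LinkU x y, LinkV x y}"
      using p by auto
    with Link(1) show ?thesis
      unfolding line_groups_def by blast
  qed
qed

lemma set_ps: "set ps = {(p, mate p) | p. p \<in> L \<and> left_of (R p) (R (mate p))}"
  using groups by (auto simp: enumerates_groups_def line_groups_iff)

lemma ps_nth:
  assumes "t < length ps"
  shows "pair_line_id ps (t, True) = mate (pair_line_id ps (t, False))"
    and "pair_line_id ps (t, False) \<in> L"
    and "left_of (R (pair_line_id ps (t, False))) (R (mate (pair_line_id ps (t, False))))"
  using nth_mem[OF assms] unfolding set_ps by (auto simp: pair_line_id_def)

lemma pair_line_id_eq_mate:
  assumes "t < length ps"
  shows "pair_line_id ps (t, \<not> b) = mate (pair_line_id ps (t, b))"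
  using ps_nth(1)[OF assms] mate_mate[OF ps_nth(2)[OF assms]] by (cases b) simp_all

lemma ps_left_of:
  assumes "t < length ps"
  shows "left_of (R (pair_line_id ps (t, False))) (R (pair_line_id ps (t, True)))"
  using ps_nth(1,3)[OF assms] by simp

lemma left_of_mate_iff:
  assumes "t < length ps"
  shows "left_of (R (pair_line_id ps (t, b))) (R (mate (pair_line_id ps (t, b)))) \<longleftrightarrow> \<not> b"
proof (cases b)
  case True
  have "mate (pair_line_id ps (t, True)) = pair_line_id ps (t, False)"
    using pair_line_id_eq_mate[OF assms, of True] by simp
  with True show ?thesis
    using left_of_asym[OF ps_left_of[OF assms]] by simp
next
  case False
  then show ?thesis
    using ps_nth(3)[OF assms] by simp
qed

lemma ps_nth_eq:
  assumes "t < length ps"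
  shows "ps ! t = (if b then (mate (pair_line_id ps (t, b)), pair_line_id ps (t, b))
    else (pair_line_id ps (t, b), mate (pair_line_id ps (t, b))))"
  using pair_line_id_eq_mate[OF assms, of b] by (auto simp: pair_line_id_def prod_eq_iff)

lemma mate_comparable:
  assumes "l \<in> L"
  shows "left_of (R l) (R (mate l)) \<or> left_of (R (mate l)) (R l)"
  using assms
proof (cases rule: line_ids_cases)
  case (Ell x)
  obtain i j where x: "x = (i, j)" by fastforce
  define y where "y = (i, if l = Ell1 x then (j + 1) mod 3 else (j + 2) mod 3)"
  have y: "y \<in> occs \<phi>" "y \<noteq> x" "mate l \<in> {Ell1 y, Ell2 y}"
    using Ell mem_occsD[of i j \<phi>] by (auto simp: x y_def occs_def)
  show ?thesis
    using occ_left_total[OF Ell(1) y(1)] y(2,3) Ell(2) unfolding occ_left_def by blast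
next
  case (Link x y)
  then show ?thesis
    using Links_comparable[of x y] by auto
qed

lemma bij_betw_pair_line_id: "bij_betw (pair_line_id ps) (indices (length ps)) L"
proof (rule bij_betw_imageI)
  have in_L: "pair_line_id ps (t, b) \<in> L" if "t < length ps" for t b
    using ps_nth(1,2)[OF that] mate_in_line_ids by (cases b) simp_all
  have "(t, b) = (t', b')"
    if t: "t < length ps" "t' < length ps"
      and same: "pair_line_id ps (t, b) = pair_line_id ps (t', b')"
    for t t' b b'
  proof -
    have "b = b'"
      using left_of_mate_iff[OF t(1), of b] left_of_mate_iff[OF t(2), of b'] same by simp
    moreover from this have "ps ! t = ps ! t'"
      unfolding ps_nth_eq[OF t(1), of b] ps_nth_eq[OF t(2), of b'] same by simp
    ultimately show ?thesis
      using groups t by (simp add: enumerates_groups_def nth_eq_iff_index_eq)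
  qed
  then show "inj_on (pair_line_id ps) (indices (length ps))"
    by (auto simp: inj_on_def)
  have "l \<in> pair_line_id ps ` indices (length ps)" if l: "l \<in> L" for l
  proof -
    have "(l, mate l) \<in> set ps \<or> (mate l, l) \<in> set ps"
      using mate_comparable[OF l] l mate_in_line_ids mate_mate unfolding set_ps by force
    then obtain t where "t < length ps" "ps ! t = (l, mate l) \<or> ps ! t = (mate l, l)"
      by (auto simp: in_set_conv_nth)
    then have "l = pair_line_id ps (t, False) \<or> l = pair_line_id ps (t, True)"
      by (auto simp: pair_line_id_def)
    with \<open>t < length ps\<close> show ?thesis by blast
  qed
  with in_L show "pair_line_id ps ` indices (length ps) = L"
    by auto
qed

sublocale line_pairs R ps
proof
  fix i j
  assume "i \<in> indices (length ps)" "j \<in> indices (length ps)" "i \<noteq> j"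
  then have "pair_line_id ps i \<in> L" "pair_line_id ps j \<in> L" "pair_line_id ps i \<noteq> pair_line_id ps j"
    using bij_betw_pair_line_id by (auto simp: bij_betw_def inj_on_def)
  then show "disjoint_endpoints (R (pair_line_id ps i)) (R (pair_line_id ps j))"
    by (rule L_disjoint_endpoints)
qed (rule ps_left_of)

lemma forced_slopes_imp_consistent_slopes:
  assumes "forced_slopes I base (D \<circ> fst)"
  shows "consistent_slopes (D \<circ> fst \<circ> inv_into I (pair_line_id ps))"
  unfolding consistent_slopes_def
proof (intro conjI ballI)
  have image: "pair_line_id ps ` I = L"
    using bij_betw_pair_line_id by (rule bij_betw_imp_surj_on)
  show "forced_slopes L R (D \<circ> fst \<circ> inv_into I (pair_line_id ps))"
  proof (rule forced_slopes_reindex[OF assms])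
    fix l assume "l \<in> L"
    then have "l \<in> pair_line_id ps ` I"
      unfolding image .
    then show "inv_into I (pair_line_id ps) l \<in> I" "base (inv_into I (pair_line_id ps) l) = R l"
      unfolding base_def by (simp_all only: inv_into_into f_inv_into_f)
  qed
  fix l assume "l \<in> L"
  then obtain t b where t: "t < length ps" and l: "l = pair_line_id ps (t, b)"
    unfolding image[symmetric] by auto
  then have "mate l = pair_line_id ps (t, \<not> b)"
    by (simp add: pair_line_id_eq_mate)
  with t l show "(D \<circ> fst \<circ> inv_into I (pair_line_id ps)) (mate l) =
      (D \<circ> fst \<circ> inv_into I (pair_line_id ps)) l"
    using bij_betw_pair_line_id by (simp add: bij_betw_def inv_into_f_f)
qed

lemma arrangement_imp_parallel_redrawing:
  assumes "arrangement \<phi> R S" and parallel: "\<And>l. l \<in> L \<Longrightarrow> slope (S (mate l)) = slope (S l)"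
  shows "parallel_redrawing (S \<circ> pair_line_id ps)"
proof -
  have in_L: "pair_line_id ps i \<in> L" if "i \<in> I" for i
    using bij_betw_pair_line_id that by (auto simp: bij_betw_def)
  have "slope (S (pair_line_id ps (t, False))) = slope (S (pair_line_id ps (t, True)))"
    if "t < length ps" for t
    using parallel[OF ps_nth(2)[OF that]] ps_nth(1)[OF that] by simp
  moreover have
    "left_of (S (pair_line_id ps i)) (S (pair_line_id ps j)) \<longleftrightarrow> left_of (base i) (base j)"
    if "i \<in> I" "j \<in> I" for i j
    using arrangement_left_of_iff[OF assms(1)] in_L that by (simp add: base_def)
  moreover have "disjoint_endpoints (S (pair_line_id ps i)) (S (pair_line_id ps j))"
    if "i \<in> I" "j \<in> I" "i \<noteq> j" for i j
  proof (rule arrangement_disjoint_endpoints[OF assms(1)])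
    show "pair_line_id ps i \<noteq> pair_line_id ps j"
      using bij_betw_pair_line_id that by (auto simp: bij_betw_def inj_on_def)
  qed (use in_L that in blast)+
  ultimately show ?thesis
    unfolding parallel_redrawing_def comp_def by blast
qed

end

theorem theorem3p2:
  fixes \<phi> :: formula
    and R :: "line_id \<Rightarrow> line"
    and ps :: "(line_id \<times> line_id) list"
  assumes "monotone_3cnf \<phi>"
    and "perm_representation \<phi> R"
    and "enumerates_groups \<phi> R ps"
  shows "nae_satisfiable \<phi> \<longleftrightarrow> bounded_tolerance_graph (H_graph R ps)"
proof -
  interpret grouped_representation \<phi> R ps
    using assms(2,3) by unfold_locales
  show ?thesis
  proof
    assume "nae_satisfiable \<phi>"
    then obtain \<tau> where "nae_assignment \<phi> \<tau>"
      unfolding nae_satisfiable_def nae_assignment_def by blast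
    then have "parallel_redrawing (layout \<tau> \<circ> pair_line_id ps)"
      using arrangement_imp_parallel_redrawing arrangement_layout slope_layout_mate assms(1)
      by blast
    then show "bounded_tolerance_graph (H_graph R ps)"
      by (rule parallel_redrawing_imp_bounded_tolerance)
  next
    assume "bounded_tolerance_graph (H_graph R ps)"
    then obtain D where "forced_slopes I base (D \<circ> fst)"
      using bounded_tolerance_imp_forced_slopes by blast
    then show "nae_satisfiable \<phi>"
      using forced_slopes_imp_consistent_slopes consistent_slopes_imp_nae_satisfiable assms(1)
      by blast
  qed
qed

end
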